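(* Let $N\ge 2$ be an integer and let $$\mathcal N_N=\{x=(x_1,\dots,x_N)\in\mathbb R^N : x_i=x_j\ \text{for some } i\ne j\}.$$ For every $u\in H_0^1(\mathbb R^N\setminus\mathcal N_N)$, $$\int_{\mathbb R^N}|\nabla u|^2\,dx\ \ge\ \frac12\int_{\mathbb R^N}|u|^2\sum_{1\le i<j\le N}\frac{1}{r_{ij}^2}\,dx.$$ Moreover the constant $\frac12$ is sharp, i.e. it cannot be replaced by any larger constant.
   Context: Here the particles are one-dimensional: $x_i\in\mathbb R$ and $r_{ij}=|x_i-x_j|$. $H_0^1(\mathbb R^N\setminus\mathcal N_N)$ is the closure of $C_0^\infty(\mathbb R^N\setminus\mathcal N_N)$ in $H^1$. *)

theory Defs
  imports "HOL-Analysis.Analysis"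
begin

text \<open>Functions of class \<open>C\<^sup>k\<close> on the whole space.  Differentiability is meant in the sense of Frechet.\<close>

fun Ck :: "nat \<Rightarrow> ('a::real_normed_vector \<Rightarrow> 'b::real_normed_vector) \<Rightarrow> bool" where
  "Ck 0 f \<longleftrightarrow> continuous_on UNIV f"
| "Ck (Suc k) f \<longleftrightarrow> (\<forall>x. f differentiable (at x)) \<and>
     (\<forall>v. Ck k (\<lambda>x. frechet_derivative f (at x) v))"

text \<open>\<open>C\<^sub>0\<^sup>\<infinity>(\<Omega>)\<close>: the elements are extended by \<open>0\<close> to the whole space.  Since the support is a
  compact subset of the open set \<open>\<Omega>\<close>, smoothness on \<open>\<Omega>\<close> and of the extension are the same.\<close>

definition test_functions :: "(real^'n) set \<Rightarrow> (real^'n \<Rightarrow> complex) set" where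
  "test_functions \<Omega> = {\<phi>. (\<forall>k. Ck k \<phi>) \<and>
     compact (closure {x. \<phi> x \<noteq> 0}) \<and> closure {x. \<phi> x \<noteq> 0} \<subseteq> \<Omega>}"

definition partial_deriv :: "'n \<Rightarrow> (real^'n \<Rightarrow> complex) \<Rightarrow> real^'n \<Rightarrow> complex" where
  "partial_deriv i \<phi> x = frechet_derivative \<phi> (at x) (axis i 1)"

definition locally_integrable :: "('a::euclidean_space \<Rightarrow> 'b::euclidean_space) \<Rightarrow> bool" where
  "locally_integrable f \<longleftrightarrow> (\<forall>K. compact K \<longrightarrow> set_integrable lebesgue K f)"

definition square_integrable :: "('a::euclidean_space \<Rightarrow> 'b::euclidean_space) \<Rightarrow> bool" where
  "square_integrable f \<longleftrightarrow>
     f \<in> borel_measurable lebesgue \<and> integrable lebesgue (\<lambda>x. (norm (f x))\<^sup>2)"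

definition has_weak_gradient :: "(real^'n \<Rightarrow> complex) \<Rightarrow> (real^'n \<Rightarrow> complex^'n) \<Rightarrow> bool" where
  "has_weak_gradient u g \<longleftrightarrow> locally_integrable u \<and> locally_integrable g \<and>
     (\<forall>\<phi>\<in>test_functions UNIV. \<forall>i.
        (LINT x|lebesgue. u x * partial_deriv i \<phi> x) = - (LINT x|lebesgue. g x $ i * \<phi> x))"

text \<open>The weak gradient is determined only up to a null set; a representative is chosen.  The
  Hermitian norm on \<open>complex^'n\<close> makes \<open>(norm (weak_gradient u x))\<^sup>2\<close> the sum of the
  squared moduli of the partial derivatives.\<close>

definition weak_gradient :: "(real^'n \<Rightarrow> complex) \<Rightarrow> real^'n \<Rightarrow> complex^'n" where
  "weak_gradient u = (SOME g. has_weak_gradient u g)"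

text \<open>The Sobolev space \<open>H\<^sup>1\<close> of the whole space.  Its elements are functions, not
  classes of functions modulo equality almost everywhere.\<close>

definition H1 :: "(real^'n \<Rightarrow> complex) set" where
  "H1 = {u. square_integrable u \<and> (\<exists>g. has_weak_gradient u g \<and> square_integrable g)}"

definition H1_norm :: "(real^'n \<Rightarrow> complex) \<Rightarrow> real" where
  "H1_norm u = sqrt ((LINT x|lebesgue. (norm (u x))\<^sup>2)
                   + (LINT x|lebesgue. (norm (weak_gradient u x))\<^sup>2))"

definition H1_0 :: "(real^'n) set \<Rightarrow> (real^'n \<Rightarrow> complex) set" where
  "H1_0 \<Omega> = {u \<in> H1. \<forall>\<epsilon>>0. \<exists>\<phi>\<in>test_functions \<Omega>. H1_norm (\<lambda>x. u x - \<phi> x) < \<epsilon>}"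

definition collision_set :: "(real^'n) set" where
  "collision_set = {x. \<exists>i j. i \<noteq> j \<and> x $ i = x $ j}"

definition dirichlet_energy :: "(real^'n \<Rightarrow> complex) \<Rightarrow> ennreal" where
  "dirichlet_energy u = (\<integral>\<^sup>+x. ennreal ((norm (weak_gradient u x))\<^sup>2) \<partial>lebesgue)"

text \<open>On the collision set, which is a null set, the weight takes irrelevant values because
  \<open>1 / 0 = 0\<close>.\<close>

definition hardy_integral :: "(real^'n::{finite,linorder} \<Rightarrow> complex) \<Rightarrow> ennreal" where
  "hardy_integral u =
     (\<integral>\<^sup>+x. ennreal ((norm (u x))\<^sup>2 * (\<Sum>(i, j)\<in>{(i, j). i < j}. 1 / \<bar>x $ i - x $ j\<bar>\<^sup>2)) \<partial>lebesgue)"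

end

theory Submission
  imports Defs
begin

text \<open>Let \<open>W = \<Sum>\<^bsub>i<j\<^esub> 1 / r\<^bsub>ij\<^esub>\<^sup>2\<close>.  The square root of the Vandermonde product \<open>\<Prod>\<^bsub>i<j\<^esub> (x\<^sub>i - x\<^sub>j)\<close> is a formal ground
  state of \<open>- \<Delta> - W / 2\<close>: its logarithmic gradient \<open>F\<^sub>i = 1/2 \<Sum>\<^bsub>j\<noteq>i\<^esub> 1/(x\<^sub>i - x\<^sub>j)\<close> satisfies
  \<open>div F + \<bar>F\<bar>\<^sup>2 = - W / 2\<close>, because the mixed terms in \<open>\<bar>F\<bar>\<^sup>2\<close> cancel (\<open>reciprocal_sum_square\<close>).  Integrating
  \<open>\<bar>\<nabla>\<phi> - F \<phi>\<bar>\<^sup>2 \<ge> 0\<close> by parts proves the inequality for test functions \<open>\<phi>\<close> supported away from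
  collisions (\<open>hardy_inequality_test\<close>).  It extends to \<open>H\<^sub>0\<^sup>1\<close> by density, after truncating the weight
  (\<open>hardy_inequality_truncated\<close>).  Since the weak gradient is only a chosen representative, this step needs
  the almost everywhere uniqueness of weak gradients (\<open>has_weak_gradient_unique\<close>), which rests on the
  fundamental lemma of the calculus of variations.

  For sharpness one looks at configurations in which two particles \<open>i, j\<close> are close to each other and
  all other distances are large.  With \<open>t = x\<^sub>i - x\<^sub>j\<close> and \<open>u = sqrt t v\<close>, where \<open>v\<close> is smooth and compactly supported
  in \<open>t > 0\<close>, one has
  \<open>\<integral> \<bar>\<nabla>u\<bar>\<^sup>2 = \<integral> t \<bar>\<nabla>v\<bar>\<^sup>2 + 1/2 \<integral> \<bar>u\<bar>\<^sup>2 / t\<^sup>2\<close> (\<open>ground_state_identity\<close>).  For \<open>v\<close> the product of a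
  logarithmic cutoff on \<open>exp (-R) \<le> t \<le> 1\<close> and a cutoff in the remaining coordinates, the first term on the right
  stays bounded as \<open>R\<close> tends to infinity (\<open>trial_gradient_le\<close>), while \<open>\<integral> \<bar>u\<bar>\<^sup>2 / t\<^sup>2\<close> grows at least linearly in \<open>R\<close>
  (\<open>trial_mass_ge\<close>).\<close>

section \<open>Functions of class \<open>C\<^sup>k\<close> on an open set\<close>

text \<open>The class \<open>C\<^sup>k\<close> on a set \<open>S\<close>, which is open in every use.  Derivatives are two-sided at the points
  of \<open>S\<close>, so for open \<open>S\<close> the predicate depends only on the values of the function in \<open>S\<close>.\<close>

fun Ck_on :: "nat \<Rightarrow> 'a set \<Rightarrow> ('a::real_normed_vector \<Rightarrow> 'b::real_normed_vector) \<Rightarrow> bool" where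
  "Ck_on 0 S f \<longleftrightarrow> continuous_on S f"
| "Ck_on (Suc k) S f \<longleftrightarrow> (\<forall>x\<in>S. f differentiable (at x)) \<and>
     (\<forall>v. Ck_on k S (\<lambda>x. frechet_derivative f (at x) v))"

lemma Ck_on_UNIV: "Ck_on k UNIV f \<longleftrightarrow> Ck k f"
  by (induction k arbitrary: f) auto

lemma Ck_on_cong:
  assumes "open S" "\<And>x. x \<in> S \<Longrightarrow> f x = g x" "Ck_on k S f"
  shows "Ck_on k S g"
  using assms(2,3)
proof (induction k arbitrary: f g)
  case 0
  then show ?case using continuous_on_cong by fastforce
next
  case (Suc k)
  have d: "(g has_derivative frechet_derivative f (at x)) (at x)" if "x \<in> S" for x
    using Suc.prems that assms(1)
    by (metis Ck_on.simps(2) frechet_derivative_works has_derivative_transform_within_open)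
  then have "frechet_derivative g (at x) = frechet_derivative f (at x)" if "x \<in> S" for x
    using that frechet_derivative_at by metis
  then have "Ck_on k S (\<lambda>x. frechet_derivative g (at x) v)" for v
    using Suc.IH[of "\<lambda>x. frechet_derivative f (at x) v" "\<lambda>x. frechet_derivative g (at x) v"]
      Suc.prems by simp
  then show ?case using d by (auto intro: differentiableI)
qed

text \<open>The introduction rule behind most closure properties below: it suffices to exhibit some derivative
  whose directional values are of class \<open>C\<^sup>k\<close>.\<close>

lemma Ck_on_SucI:
  assumes "open S" "\<And>x. x \<in> S \<Longrightarrow> (f has_derivative f' x) (at x)"
    and "\<And>v. Ck_on k S (\<lambda>x. f' x v)"
  shows "Ck_on (Suc k) S f"
proof -
  have "f' x v = frechet_derivative f (at x) v" if "x \<in> S" for x v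
    using that frechet_derivative_at[OF assms(2)] by simp
  then show ?thesis using assms differentiableI[OF assms(2)]
    using Ck_on_cong[OF assms(1) _ assms(3)] by auto
qed

lemma Ck_on_SucD:
  assumes "Ck_on (Suc k) S f" "x \<in> S"
  shows "(f has_derivative frechet_derivative f (at x)) (at x)"
    and "Ck_on k S (\<lambda>x. frechet_derivative f (at x) v)"
  using assms frechet_derivative_works by auto

lemma Ck_on_Suc_imp: "Ck_on (Suc k) S f \<Longrightarrow> Ck_on k S f"
proof (induction k arbitrary: f)
  case 0
  then show ?case
    by (simp add: continuous_at_imp_continuous_on differentiable_imp_continuous_within)
qed auto

lemma Ck_on_continuous: "Ck_on k S f \<Longrightarrow> continuous_on S f"
  by (induction k) (use Ck_on_Suc_imp in auto)

lemma Ck_on_subset: "Ck_on k S f \<Longrightarrow> T \<subseteq> S \<Longrightarrow> Ck_on k T f"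
  by (induction k arbitrary: f) (auto intro: continuous_on_subset)

lemma Ck_on_Un:
  "open A \<Longrightarrow> open B \<Longrightarrow> Ck_on k A f \<Longrightarrow> Ck_on k B f \<Longrightarrow> Ck_on k (A \<union> B) f"
  by (induction k arbitrary: f) (auto intro: continuous_on_open_Un)

lemma Ck_on_const: "open S \<Longrightarrow> Ck_on k S (\<lambda>x. c)"
  by (induction k arbitrary: c) auto

lemma Ck_on_bounded_linear:
  assumes "bounded_linear L" "open S"
  shows "Ck_on k S L"
proof (cases k)
  case 0
  then show ?thesis using assms linear_continuous_on by auto
next
  case (Suc m)
  then show ?thesis using assms
    using Ck_on_SucI[of S L "\<lambda>x. L"] bounded_linear_imp_has_derivative Ck_on_const by metis
qed

lemma Ck_on_bounded_linear_compose:
  assumes "bounded_linear L" "open S"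
  shows "Ck_on k S f \<Longrightarrow> Ck_on k S (\<lambda>x. L (f x))"
proof (induction k arbitrary: f)
  case 0
  then show ?case using assms bounded_linear.continuous_on by auto
next
  case (Suc k)
  show ?case
    by (rule Ck_on_SucI[OF assms(2), where f' = "\<lambda>x v. L (frechet_derivative f (at x) v)"])
      (use Suc.IH Suc.prems Ck_on_SucD(1)[OF Suc.prems] in
        \<open>auto intro: bounded_linear.has_derivative[OF assms(1)]\<close>)
qed

lemma Ck_on_add:
  assumes "open S"
  shows "Ck_on k S f \<Longrightarrow> Ck_on k S g \<Longrightarrow> Ck_on k S (\<lambda>x. f x + g x)"
proof (induction k arbitrary: f g)
  case 0
  then show ?case by (auto intro: continuous_on_add)
next
  case (Suc k)
  show ?case
    by (rule Ck_on_SucI[OF assms, where f' = "\<lambda>x v. frechet_derivative f (at x) v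
           + frechet_derivative g (at x) v"])
      (use Suc.IH Ck_on_SucD[OF Suc.prems(1)] Ck_on_SucD[OF Suc.prems(2)] Suc.prems
        in \<open>auto intro!: has_derivative_add\<close>)
qed

lemma Ck_on_mult:
  fixes f g :: "'a::real_normed_vector \<Rightarrow> 'b::real_normed_algebra"
  assumes "open S"
  shows "Ck_on k S f \<Longrightarrow> Ck_on k S g \<Longrightarrow> Ck_on k S (\<lambda>x. f x * g x)"
proof (induction k arbitrary: f g)
  case 0
  then show ?case by (auto intro: continuous_on_mult)
next
  case (Suc k)
  show ?case
  proof (rule Ck_on_SucI[OF assms, where f' = "\<lambda>x v. f x * frechet_derivative g (at x) v
           + frechet_derivative f (at x) v * g x"])
    show "((\<lambda>x. f x * g x) has_derivative
            (\<lambda>v. f x * frechet_derivative g (at x) v + frechet_derivative f (at x) v * g x)) (at x)"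
      if "x \<in> S" for x
      using Ck_on_SucD(1)[OF Suc.prems(1) that] Ck_on_SucD(1)[OF Suc.prems(2) that]
        has_derivative_mult by blast
    show "Ck_on k S (\<lambda>x. f x * frechet_derivative g (at x) v + frechet_derivative f (at x) v * g x)" for v
      using Suc.prems Ck_on_Suc_imp[OF Suc.prems(1)] Ck_on_Suc_imp[OF Suc.prems(2)]
      by (intro Ck_on_add[OF assms] Suc.IH) auto
  qed
qed

lemma Ck_on_prod:
  fixes f :: "'i \<Rightarrow> 'a::real_normed_vector \<Rightarrow> real"
  assumes "open S" "finite I" "\<And>i. i \<in> I \<Longrightarrow> Ck_on k S (f i)"
  shows "Ck_on k S (\<lambda>x. \<Prod>i\<in>I. f i x)"
  using assms(2,3)
  by (induction I) (auto intro!: Ck_on_mult Ck_on_const assms(1))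

text \<open>The chain rule for an outer function of one real variable that is given together with all of its
  derivatives \<open>h 0, h 1, \<dots>\<close> on \<open>T\<close>.\<close>

lemma Ck_on_compose:
  fixes h :: "nat \<Rightarrow> real \<Rightarrow> real" and g :: "'a::real_normed_vector \<Rightarrow> real"
  assumes "open S" "\<And>n t. t \<in> T \<Longrightarrow> (h n has_real_derivative h (Suc n) t) (at t)"
    and "\<And>x. x \<in> S \<Longrightarrow> g x \<in> T"
  shows "Ck_on k S g \<Longrightarrow> Ck_on k S (\<lambda>x. h n (g x))"
proof (induction k arbitrary: n)
  case 0
  have "continuous_on T (h n)"
    using assms(2) by (meson DERIV_continuous_on has_field_derivative_at_within)
  then show ?case
    using 0 continuous_on_compose2[of T "h n" S g] assms(3) by auto
next
  case (Suc k)
  show ?case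
  proof (rule Ck_on_SucI[OF assms(1), where f' = "\<lambda>x v. frechet_derivative g (at x) v * h (Suc n) (g x)"])
    show "((\<lambda>x. h n (g x)) has_derivative (\<lambda>v. frechet_derivative g (at x) v * h (Suc n) (g x))) (at x)"
      if "x \<in> S" for x
      using DERIV_compose_FDERIV[OF assms(2)[OF assms(3)[OF that]] Ck_on_SucD(1)[OF Suc.prems that]]
      by simp
    show "Ck_on k S (\<lambda>x. frechet_derivative g (at x) v * h (Suc n) (g x))" for v
      using Suc.prems Suc.IH[OF Ck_on_Suc_imp[OF Suc.prems]]
      by (intro Ck_on_mult[OF assms(1)]) auto
  qed
qed

lemma Ck_on_powr:
  fixes g :: "'a::real_normed_vector \<Rightarrow> real"
  assumes "open S" "\<And>x. x \<in> S \<Longrightarrow> g x > 0" "Ck_on k S g"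
  shows "Ck_on k S (\<lambda>x. g x powr a)"
proof -
  define c where "c n = (\<Prod>i<n. a - real i)" for n
  have "((\<lambda>t. c n * t powr (a - real n)) has_real_derivative c (Suc n) * t powr (a - real (Suc n))) (at t)"
    if "t \<in> {0<..}" for t n
    using that by (auto intro!: derivative_eq_intros simp: c_def diff_diff_eq add.commute)
  then have "Ck_on k S (\<lambda>x. c 0 * g x powr (a - real 0))"
    using Ck_on_compose[of S "{0<..}" "\<lambda>n t. c n * t powr (a - real n)" g k 0] assms by auto
  then show ?thesis by (simp add: c_def)
qed

lemma Ck_on_ln:
  fixes g :: "'a::real_normed_vector \<Rightarrow> real"
  assumes "open S" "\<And>x. x \<in> S \<Longrightarrow> g x > 0" "Ck_on k S g"
  shows "Ck_on k S (\<lambda>x. ln (g x))"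
proof (cases k)
  case 0
  then show ?thesis using assms by (auto intro!: continuous_on_ln simp: less_imp_neq[THEN not_sym])
next
  case (Suc m)
  show ?thesis unfolding Suc
  proof (rule Ck_on_SucI[OF assms(1), where f' = "\<lambda>x v. frechet_derivative g (at x) v * g x powr (- 1)"])
    show "((\<lambda>x. ln (g x)) has_derivative (\<lambda>v. frechet_derivative g (at x) v * g x powr (- 1))) (at x)"
      if "x \<in> S" for x
      using DERIV_compose_FDERIV[OF DERIV_ln[OF assms(2)[OF that]]
          Ck_on_SucD(1)[OF assms(3)[unfolded Suc] that]] assms(2)[OF that]
      by (simp add: powr_minus)
    show "Ck_on m S (\<lambda>x. frechet_derivative g (at x) v * g x powr (- 1))" for v
      using assms(3)[unfolded Suc] Ck_on_Suc_imp[OF assms(3)[unfolded Suc]]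
      by (intro Ck_on_mult[OF assms(1)] Ck_on_powr assms) auto
  qed
qed

section \<open>A smooth function that vanishes on a half-line\<close>

text \<open>The functions \<open>p(1/x) exp(-1/x)\<close> on the positive half-line, with \<open>p\<close> a polynomial, extended by \<open>0\<close>.
  This family is closed under differentiation, which makes all its members smooth.\<close>

definition flat :: "real poly \<Rightarrow> real \<Rightarrow> real" where
  "flat p x = (if x > 0 then poly p (1 / x) * exp (- 1 / x) else 0)"

lemma poly_exp_tendsto_0: "((\<lambda>t. poly p t * exp (- t)) \<longlongrightarrow> (0::real)) at_top"
proof -
  have "((\<lambda>t. \<Sum>i\<le>degree p. coeff p i * (t ^ i / exp t)) \<longlongrightarrow> (\<Sum>i\<le>degree p. coeff p i * 0)) at_top"
    by (intro tendsto_sum tendsto_mult tendsto_const tendsto_power_div_exp_0)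
  then show ?thesis
    by (simp add: poly_altdef sum_distrib_right exp_minus divide_inverse mult.assoc)
qed

lemma flat_deriv:
  "(flat p has_real_derivative flat ([:0,0,1:] * (p - pderiv p)) x) (at x)"
proof -
  let ?q = "[:0,0,1:] * (p - pderiv p)"
  consider "x > 0" | "x < 0" | "x = 0" by linarith
  then show ?thesis
  proof cases
    case 1
    have "((\<lambda>x. poly p (1 / x) * exp (- 1 / x)) has_real_derivative flat ?q x) (at x)"
      using 1 by (auto intro!: derivative_eq_intros DERIV_chain2[OF poly_DERIV]
          simp: flat_def field_simps power2_eq_square)
    then show ?thesis
      by (rule has_field_derivative_transform_within_open[where S = "{0<..}"])
        (use 1 in \<open>auto simp: flat_def\<close>)
  next
    case 2
    have "((\<lambda>x. 0) has_real_derivative flat ?q x) (at x)"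
      using 2 by (simp add: flat_def)
    then show ?thesis
      by (rule has_field_derivative_transform_within_open[where S = "{..<0}"])
        (use 2 in \<open>auto simp: flat_def\<close>)
  next
    case 3
    have "((\<lambda>y. poly ([:0,1:] * p) (inverse y) * exp (- inverse y)) \<longlongrightarrow> 0) (at_right (0::real))"
      using filterlim_compose[OF poly_exp_tendsto_0 filterlim_inverse_at_top_right] .
    moreover have "\<forall>\<^sub>F y in at_right (0::real). poly ([:0,1:] * p) (inverse y) * exp (- inverse y)
        = (flat p y - flat p 0) / (y - 0)"
      by (rule eventually_at_right_less[THEN eventually_mono]) (simp add: flat_def divide_inverse)
    ultimately have r: "((\<lambda>y. (flat p y - flat p 0) / (y - 0)) \<longlongrightarrow> 0) (at_right (0::real))"
      using tendsto_cong by fast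
    have "\<forall>\<^sub>F y in at_left (0::real). 0 = (flat p y - flat p 0) / (y - 0)"
      by (rule eventually_at_left_real[of "-1",THEN eventually_mono]) (auto simp: flat_def)
    then have l: "((\<lambda>y. (flat p y - flat p 0) / (y - 0)) \<longlongrightarrow> 0) (at_left (0::real))"
      using tendsto_cong tendsto_const by fast
    have "((\<lambda>y. (flat p y - flat p 0) / (y - 0)) \<longlongrightarrow> 0) (at (0::real))"
      using l r filterlim_split_at by blast
    then show ?thesis unfolding 3 has_field_derivative_iff by (simp add: flat_def)
  qed
qed

text \<open>The smooth building block of all cutoff functions.  It is positive exactly on the positive half-line;
  functions with compact support arise as products \<open>bump (x - a) * bump (b - x)\<close>.\<close>

definition bump :: "real \<Rightarrow> real" where
  "bump x = (if x > 0 then exp (- 1 / x) else 0)"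

lemma bump_nonneg: "bump x \<ge> 0" and bump_le_1: "bump x \<le> 1" and bump_pos: "x > 0 \<Longrightarrow> bump x > 0"
  and bump_eq_0: "x \<le> 0 \<Longrightarrow> bump x = 0"
  by (auto simp: bump_def)

lemma bump_flat: "bump = flat 1" by (auto simp: bump_def flat_def)

lemma Ck_on_bump:
  fixes g :: "'a::real_normed_vector \<Rightarrow> real"
  assumes "open S" "Ck_on k S g"
  shows "Ck_on k S (\<lambda>x. bump (g x))"
proof -
  define P where "P n = ((\<lambda>p::real poly. [:0,0,1:] * (p - pderiv p)) ^^ n) 1" for n
  have "(flat (P n) has_real_derivative flat (P (Suc n)) t) (at t)" for n t
    using flat_deriv[of "P n"] by (simp add: P_def)
  then have "Ck_on k S (\<lambda>x. flat (P 0) (g x))"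
    using Ck_on_compose[of S UNIV "\<lambda>n. flat (P n)"] assms by auto
  then show ?thesis by (simp add: P_def bump_flat)
qed

section \<open>Integrals of directional derivatives\<close>

lemma integrable_continuous_on_compact:
  fixes f :: "'a::euclidean_space \<Rightarrow> 'b::{banach, second_countable_topology}"
  assumes "compact K" "continuous_on K f" "\<And>x. x \<notin> K \<Longrightarrow> f x = 0"
  shows "integrable lborel f"
proof -
  have "(\<lambda>x. indicator K x *\<^sub>R f x) = f"
    using assms(3) by (fastforce simp: indicator_def)
  then show ?thesis using borel_integrable_compact[OF assms(1,2)] by simp
qed

lemma lborel_integral_translate:
  fixes f :: "'a::euclidean_space \<Rightarrow> 'b::{banach, second_countable_topology}"
  assumes "f \<in> borel_measurable borel"
  shows "(LINT x|lborel. f (x + c)) = (LINT x|lborel. f x)"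
  using integral_distr[of "(+) c" lborel borel f] assms
  by (simp add: lborel_distr_plus add.commute)

lemma lborel_integrable_translate:
  fixes f :: "'a::euclidean_space \<Rightarrow> 'b::{banach, second_countable_topology}"
  assumes "integrable lborel f"
  shows "integrable lborel (\<lambda>x. f (x + c))"
  using integrable_distr[of "(+) c" lborel borel f] assms
  by (simp add: lborel_distr_plus add.commute)

lemma lborel_nn_integral_translate:
  fixes f :: "'a::euclidean_space \<Rightarrow> ennreal"
  assumes "f \<in> borel_measurable borel"
  shows "(\<integral>\<^sup>+x. f (x + c) \<partial>lborel) = (\<integral>\<^sup>+x. f x \<partial>lborel)"
  using nn_integral_distr[of "(+) c" lborel borel f] assms
  by (simp add: lborel_distr_plus add.commute)

text \<open>The only form of integration by parts that is needed.  By translation invariance the difference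
  quotients of \<open>f\<close> in the direction \<open>v\<close> have integral \<open>0\<close>; they converge to the directional
  derivative and are dominated, so no iterated integration is required.\<close>

lemma integral_directional_derivative_eq_0:
  fixes f :: "'a::euclidean_space \<Rightarrow> 'b::{banach, second_countable_topology}"
  assumes der: "\<And>x. (f has_derivative f' x) (at x)"
    and cont: "continuous_on UNIV (\<lambda>x. f' x v)"
    and K: "compact K" "\<And>x. x \<notin> K \<Longrightarrow> f x = 0"
  shows "(LINT x|lborel. f' x v) = 0"
proof -
  have f'0: "f' x v = 0" if "x \<notin> K" for x
  proof -
    have "(f has_derivative (\<lambda>_. 0)) (at x)"
      by (rule has_derivative_transform_within_open[OF has_derivative_const, of "- K"])
        (use that K compact_imp_closed in auto)
    then show ?thesis using der has_derivative_unique by fastforce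
  qed
  obtain M where M: "M \<ge> 0" "\<And>x. norm (f' x v) \<le> M"
  proof -
    have "bounded ((\<lambda>x. f' x v) ` K)"
      by (intro compact_imp_bounded compact_continuous_image continuous_on_subset[OF cont] K) auto
    then obtain M where "M > 0" "\<And>x. x \<in> K \<Longrightarrow> norm (f' x v) \<le> M"
      by (auto simp: bounded_pos)
    then show ?thesis using that[of M] f'0 by (metis less_imp_le norm_zero)
  qed
  have fc: "continuous_on UNIV f"
    by (intro continuous_at_imp_continuous_on ballI has_derivative_continuous[OF der])
  obtain r where r: "r > 0" "K \<subseteq> cball 0 r"
    using bounded_subset_ballD[OF compact_imp_bounded[OF K(1)], of 0] ball_subset_cball by blast
  have line: "((\<lambda>s. f (x + s *\<^sub>R v)) has_vector_derivative f' (x + s *\<^sub>R v) v) (at s)" for x s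
  proof -
    have "((\<lambda>s. x + s *\<^sub>R v) has_derivative (\<lambda>d. d *\<^sub>R v)) (at s)"
      by (auto intro!: derivative_eq_intros)
    from has_derivative_compose[OF this der]
    show ?thesis
      unfolding has_vector_derivative_def
      by (simp add: linear_scale[OF has_derivative_linear[OF der]])
  qed
  have lip: "norm (f (x + h *\<^sub>R v) - f x) \<le> M * h" if "h \<ge> 0" for x h
  proof -
    have "norm (f (x + h *\<^sub>R v) - f (x + 0 *\<^sub>R v)) \<le> M * norm (h - 0)"
    proof (rule differentiable_bound[where S = "UNIV" and f' = "\<lambda>s d. d *\<^sub>R f' (x + s *\<^sub>R v) v"])
      show "onorm (\<lambda>d. d *\<^sub>R f' (x + s *\<^sub>R v) v) \<le> M" for s
        using M by (intro onorm_le) (auto simp: mult.commute[of M] intro!: mult_left_mono)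
    qed (use line in \<open>auto simp: has_vector_derivative_def\<close>)
    then show ?thesis using that by simp
  qed
  define h where "h n = inverse (real (Suc n))" for n
  have h: "h n > 0" "h n \<le> 1" for n by (auto simp: h_def field_simps)
  define q where "q n x = (f (x + h n *\<^sub>R v) - f x) /\<^sub>R h n" for n x
  have fi: "integrable lborel f"
    using integrable_continuous_on_compact[of K f] K fc continuous_on_subset by blast
  have "(LINT x|lborel. q n x) = 0" for n
  proof -
    have "(LINT x|lborel. f (x + h n *\<^sub>R v) - f x) = 0"
      using fi lborel_integrable_translate[OF fi] lborel_integral_translate[of f]
      by (subst Bochner_Integration.integral_diff) auto
    then show ?thesis unfolding q_def by (simp del: scaleR_right_diff_distrib)
  qed
  moreover have "(\<lambda>n. LINT x|lborel. q n x) \<longlonglongrightarrow> (LINT x|lborel. f' x v)"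
  proof (rule integral_dominated_convergence)
    show "integrable lborel (\<lambda>x::'a. indicator (cball 0 (r + norm v)) x *\<^sub>R M)"
      by (rule borel_integrable_compact) auto
    show "(\<lambda>x. f' x v) \<in> borel_measurable lborel"
      using cont by (simp add: borel_measurable_continuous_onI)
    show "q n \<in> borel_measurable lborel" for n
    proof -
      have "continuous_on UNIV (q n)"
        unfolding q_def
        by (intro continuous_intros continuous_on_compose2[OF fc]) auto
      then show ?thesis by (simp add: borel_measurable_continuous_onI)
    qed
    show "AE x in lborel. (\<lambda>n. q n x) \<longlonglongrightarrow> f' x v"
    proof (rule AE_I2)
      fix x
      have "((\<lambda>s. f (x + s *\<^sub>R v)) has_vector_derivative f' x v) (at 0)"
        using line[of x 0] by simp
      then have "((\<lambda>s. norm (f (x + s *\<^sub>R v) - f x - s *\<^sub>R f' x v) / norm s) \<longlongrightarrow> 0) (at 0)"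
        unfolding has_vector_derivative_def has_derivative_at by simp
      moreover have "norm (f (x + s *\<^sub>R v) - f x - s *\<^sub>R f' x v) / norm s
          = norm ((f (x + s *\<^sub>R v) - f x) /\<^sub>R s - f' x v)" if "s \<noteq> 0" for s
      proof -
        have "(f (x + s *\<^sub>R v) - f x) /\<^sub>R s - f' x v = (f (x + s *\<^sub>R v) - f x - s *\<^sub>R f' x v) /\<^sub>R s"
          using that by (simp add: scaleR_right_diff_distrib)
        then show ?thesis using that by (simp add: divide_inverse mult.commute)
      qed
      then have "\<forall>\<^sub>F s in at 0. norm (f (x + s *\<^sub>R v) - f x - s *\<^sub>R f' x v) / norm s
          = norm ((f (x + s *\<^sub>R v) - f x) /\<^sub>R s - f' x v)"
        unfolding eventually_at_filter by simp
      ultimately have "((\<lambda>s. norm ((f (x + s *\<^sub>R v) - f x) /\<^sub>R s - f' x v)) \<longlongrightarrow> 0) (at 0)"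
        by (simp add: tendsto_cong)
      then have "((\<lambda>s. (f (x + s *\<^sub>R v) - f x) /\<^sub>R s) \<longlongrightarrow> f' x v) (at 0)"
        by (rule LIM_zero_cancel[OF tendsto_norm_zero_cancel])
      moreover have "filterlim h (at 0) sequentially"
      proof (rule filterlim_atI)
        show "h \<longlonglongrightarrow> 0" unfolding h_def by (rule LIMSEQ_inverse_real_of_nat)
        show "\<forall>\<^sub>F n in sequentially. h n \<noteq> 0" by (simp add: h_def)
      qed
      ultimately show "(\<lambda>n. q n x) \<longlonglongrightarrow> f' x v"
        unfolding q_def by (rule filterlim_compose)
    qed
    show "AE x in lborel. norm (q n x) \<le> indicator (cball 0 (r + norm v)) x *\<^sub>R M" for n
    proof (rule AE_I2)
      fix x
      show "norm (q n x) \<le> indicator (cball 0 (r + norm v)) x *\<^sub>R M"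
      proof (cases "x \<in> cball 0 (r + norm v)")
        case True
        have "norm (q n x) = norm (f (x + h n *\<^sub>R v) - f x) / h n"
          using h[of n] by (simp add: q_def divide_inverse mult.commute)
        also have "\<dots> \<le> M"
          using lip[of "h n" x] h[of n] by (simp add: pos_divide_le_eq)
        finally show ?thesis using True by simp
      next
        case False
        have "norm x \<le> norm (x + h n *\<^sub>R v) + h n * norm v"
          using norm_triangle_ineq4[of "x + h n *\<^sub>R v" "h n *\<^sub>R v"] h[of n] by simp
        moreover have "h n * norm v \<le> norm v"
          using h[of n] mult_right_mono[of "h n" 1 "norm v"] by simp
        ultimately have "norm (x + h n *\<^sub>R v) > r" "norm x > r"
          using False norm_ge_zero[of v] unfolding mem_cball_0 by linarith+
        then have "x + h n *\<^sub>R v \<notin> K" "x \<notin> K" using r by auto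
        then show ?thesis using K False by (simp add: q_def)
      qed
    qed
  qed
  ultimately show ?thesis by (simp add: LIMSEQ_const_iff)
qed

section \<open>Functions with vanishing integrals over boxes\<close>

text \<open>The positive and the negative part of the function are densities of two measures that agree on
  boxes, hence agree.\<close>

lemma AE_eq_0_if_box_integrals_eq_0:
  fixes h :: "'a::euclidean_space \<Rightarrow> real"
  assumes meas: "h \<in> borel_measurable lebesgue"
    and int: "\<And>a b. integrable lebesgue (\<lambda>x. indicator (box a b) x *\<^sub>R h x)"
    and zero: "\<And>a b. (LINT x|lebesgue. indicator (box a b) x *\<^sub>R h x) = 0"
  shows "AE x in lebesgue. h x = 0"
proof -
  obtain k where k[measurable]: "k \<in> borel_measurable lborel" and ae: "AE x in lborel. h x = k x"
    using completion_ex_borel_measurable_real[OF meas] by auto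
  have ae': "AE x in lebesgue. h x = k x" using ae AE_completion by blast
  have ki: "integrable lborel (\<lambda>x. indicator (box a b) x *\<^sub>R k x)"
   and kz: "(LINT x|lborel. indicator (box a b) x *\<^sub>R k x) = 0" for a b
  proof -
    have m: "(\<lambda>x. indicator (box a b) x *\<^sub>R k x) \<in> borel_measurable lborel" by measurable
    note m' = measurable_completion[OF m]
    have "integrable lebesgue (\<lambda>x. indicator (box a b) x *\<^sub>R k x)"
      by (rule integrable_cong_AE_imp[OF int[of a b]])
        (use ae' m' in \<open>auto simp del: real_scaleR_def\<close>)
    then show "integrable lborel (\<lambda>x. indicator (box a b) x *\<^sub>R k x)"
      using integrable_completion[OF m] by simp
    have "(LINT x|lebesgue. indicator (box a b) x *\<^sub>R k x) = (LINT x|lebesgue. indicator (box a b) x *\<^sub>R h x)"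
      by (rule integral_cong_AE) (use ae' m' int[THEN borel_measurable_integrable] in \<open>auto simp del: real_scaleR_def\<close>)
    then show "(LINT x|lborel. indicator (box a b) x *\<^sub>R k x) = 0"
      using zero integral_completion[OF m] by simp
  qed
  have box: "emeasure (density lborel (\<lambda>x. ennreal (k x))) (box a b)
       = emeasure (density lborel (\<lambda>x. ennreal (- k x))) (box a b)
       \<and> emeasure (density lborel (\<lambda>x. ennreal (k x))) (box a b) \<noteq> \<infinity>" for a b
  proof -
    let ?p = "\<lambda>x. max 0 (indicator (box a b) x *\<^sub>R k x)"
    let ?m = "\<lambda>x. max 0 (- (indicator (box a b) x *\<^sub>R k x))"
    have i: "integrable lborel ?p" "integrable lborel ?m"
      using ki[of a b] by auto
    have "(LINT x|lborel. ?p x) - (LINT x|lborel. ?m x) = (LINT x|lborel. ?p x - ?m x)"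
      using i by simp
    also have "(\<lambda>x. ?p x - ?m x) = (\<lambda>x. indicator (box a b) x *\<^sub>R k x)" by auto
    finally have eq: "(LINT x|lborel. ?p x) = (LINT x|lborel. ?m x)" using kz by simp
    have "emeasure (density lborel (\<lambda>x. ennreal (k x))) (box a b) = (\<integral>\<^sup>+x. ennreal (?p x) \<partial>lborel)"
      by (subst emeasure_density) (auto intro!: nn_integral_cong simp: indicator_def ennreal_neg max_def)
    moreover have "emeasure (density lborel (\<lambda>x. ennreal (- k x))) (box a b) = (\<integral>\<^sup>+x. ennreal (?m x) \<partial>lborel)"
      by (subst emeasure_density) (auto intro!: nn_integral_cong simp: indicator_def ennreal_neg max_def)
    ultimately show ?thesis
      using eq nn_integral_eq_integral[OF i(1)] nn_integral_eq_integral[OF i(2)] by simp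
  qed
  have "density lborel (\<lambda>x. ennreal (k x)) = density lborel (\<lambda>x. ennreal (- k x))"
  proof (rule measure_eqI_generator_eq)
    let ?E = "range (\<lambda>(a, b). box a b::'a set)"
    show "Int_stable ?E" by (auto simp: Int_stable_def box_Int_box)
    show "?E \<subseteq> Pow UNIV" "sets (density lborel (\<lambda>x. ennreal (k x))) = sigma_sets UNIV ?E"
      "sets (density lborel (\<lambda>x. ennreal (- k x))) = sigma_sets UNIV ?E"
      by (simp_all add: borel_eq_box)
    let ?A = "\<lambda>n::nat. box (- (real n *\<^sub>R One)) (real n *\<^sub>R One) :: 'a set"
    show "range ?A \<subseteq> ?E" "(\<Union>i. ?A i) = UNIV"
      unfolding UN_box_eq_UNIV by auto
    show "emeasure (density lborel (\<lambda>x. ennreal (k x))) (?A i) \<noteq> \<infinity>" for i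
      using box by blast
  qed (use box in auto)
  then have "AE x in lborel. ennreal (k x) = ennreal (- k x)"
    by (intro sigma_finite_measure.density_unique[OF sigma_finite_lborel]) auto
  then have "AE x in lborel. k x = 0"
  proof eventually_elim
    case (elim x)
    then show ?case
      by (cases "k x \<ge> 0") (auto simp: ennreal_neg dest: sym)
  qed
  with ae have "AE x in lborel. h x = 0" by eventually_elim simp
  then show ?thesis by (rule AE_completion)
qed

lemma locally_integrable_measurable:
  fixes f :: "'a::euclidean_space \<Rightarrow> 'b::euclidean_space"
  assumes "locally_integrable f"
  shows "f \<in> borel_measurable lebesgue"
proof (rule borel_measurable_LIMSEQ_metric)
  show "(\<lambda>x. indicator (cball 0 (real n)) x *\<^sub>R f x) \<in> borel_measurable lebesgue" for n
    using assms compact_cball unfolding locally_integrable_def set_integrable_def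
    by (intro borel_measurable_integrable) blast
  show "(\<lambda>n. indicator (cball 0 (real n)) x *\<^sub>R f x) \<longlonglongrightarrow> f x" for x
  proof -
    obtain N where "norm x \<le> real N" using real_arch_simple by blast
    then have "\<forall>\<^sub>F n in sequentially. indicator (cball 0 (real n)) x *\<^sub>R f x = f x"
      by (intro eventually_sequentiallyI[of N]) auto
    then show ?thesis by (simp add: tendsto_eventually)
  qed
qed

lemma locally_integrable_continuous:
  fixes f :: "'a::euclidean_space \<Rightarrow> 'b::euclidean_space"
  assumes "continuous_on UNIV f"
  shows "locally_integrable f"
  unfolding locally_integrable_def set_integrable_def
proof (intro allI impI)
  fix K :: "'a set" assume K: "compact K"
  have i: "integrable lborel (\<lambda>x. indicator K x *\<^sub>R f x)"
    using K assms by (intro borel_integrable_compact) (auto intro: continuous_on_subset)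
  then show "integrable lebesgue (\<lambda>x. indicator K x *\<^sub>R f x)"
    by (subst integrable_completion) auto
qed

lemma locally_integrable_mult:
  fixes f \<psi> :: "'a::euclidean_space \<Rightarrow> complex"
  assumes f: "locally_integrable f" and c: "continuous_on UNIV \<psi>"
    and K: "compact K" "\<And>x. x \<notin> K \<Longrightarrow> \<psi> x = 0"
  shows "integrable lebesgue (\<lambda>x. f x * \<psi> x)"
proof -
  have "bounded (\<psi> ` K)"
    by (intro compact_imp_bounded compact_continuous_image continuous_on_subset[OF c] K) auto
  then obtain M where M: "M > 0" "\<And>x. x \<in> K \<Longrightarrow> norm (\<psi> x) \<le> M" by (auto simp: bounded_pos)
  have i: "integrable lebesgue (\<lambda>x. indicator K x *\<^sub>R f x)"
    using f K unfolding locally_integrable_def set_integrable_def by auto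
  have [measurable]: "\<psi> \<in> borel_measurable lebesgue" "f \<in> borel_measurable lebesgue"
    using locally_integrable_measurable f locally_integrable_continuous c by auto
  show ?thesis
  proof (rule Bochner_Integration.integrable_bound)
    show "integrable lebesgue (\<lambda>x. M *\<^sub>R (indicator K x *\<^sub>R f x))"
      using integrable_scaleR_right[OF i] by blast
    show "(\<lambda>x. f x * \<psi> x) \<in> borel_measurable lebesgue" by measurable
    have "norm (f x * \<psi> x) \<le> norm (M *\<^sub>R (indicator K x *\<^sub>R f x))" for x
      using M K(2)[of x] mult_right_mono[of "norm (\<psi> x)" M "norm (f x)"]
      by (cases "x \<in> K") (auto simp: norm_mult mult.commute)
    then show "AE x in lebesgue. norm (f x * \<psi> x) \<le> norm (M *\<^sub>R (indicator K x *\<^sub>R f x))" by simp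
  qed
qed

section \<open>Test functions and the fundamental lemma of the calculus of variations\<close>

lemma test_functionsI:
  assumes "\<And>k. Ck k \<phi>" "compact K" "K \<subseteq> \<Omega>" "\<And>x. x \<notin> K \<Longrightarrow> \<phi> x = 0"
  shows "\<phi> \<in> test_functions \<Omega>"
proof -
  have sub: "closure {x. \<phi> x \<noteq> 0} \<subseteq> K"
    using assms by (intro closure_minimal compact_imp_closed) auto
  then have "compact (closure {x. \<phi> x \<noteq> 0})"
    using assms(2) compact_closure bounded_subset compact_imp_bounded closure_subset
    by (meson subset_trans)
  then show ?thesis using sub assms unfolding test_functions_def by blast
qed

lemma test_functions_derivative:
  assumes "\<phi> \<in> test_functions \<Omega>"
  shows "(\<phi> has_derivative frechet_derivative \<phi> (at x)) (at x)"
proof -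
  have "Ck 1 \<phi>" using assms unfolding test_functions_def by blast
  then show ?thesis using frechet_derivative_works by auto
qed

lemma test_functions_continuous:
  assumes "\<phi> \<in> test_functions \<Omega>"
  shows "continuous_on UNIV \<phi>"
proof -
  have "Ck 0 \<phi>" using assms unfolding test_functions_def by blast
  then show ?thesis by simp
qed

lemma continuous_partial_deriv:
  assumes "\<phi> \<in> test_functions \<Omega>"
  shows "continuous_on UNIV (partial_deriv i \<phi>)"
proof -
  have "Ck (Suc 0) \<phi>" using assms unfolding test_functions_def by blast
  then have "continuous_on UNIV (\<lambda>x. frechet_derivative \<phi> (at x) (axis i 1))" by simp
  then show ?thesis unfolding partial_deriv_def .
qed

lemma frechet_derivative_eq_0:
  assumes "closed K" "\<And>x. x \<notin> K \<Longrightarrow> \<phi> x = 0" "x \<notin> K"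
  shows "frechet_derivative \<phi> (at x) = (\<lambda>_. 0)"
proof -
  have "(\<phi> has_derivative (\<lambda>_. 0)) (at x)"
    by (rule has_derivative_transform_within_open[OF has_derivative_const, of "- K"])
      (use assms in auto)
  then show ?thesis using frechet_derivative_at by metis
qed

lemma partial_deriv_eq_0:
  assumes "closed K" "\<And>x. x \<notin> K \<Longrightarrow> \<phi> x = 0" "x \<notin> K"
  shows "partial_deriv i \<phi> x = 0"
  using frechet_derivative_eq_0[OF assms] by (simp add: partial_deriv_def)

lemma test_functions_support:
  assumes "\<phi> \<in> test_functions \<Omega>"
  obtains K where "compact K" "K \<subseteq> \<Omega>" "\<And>x. x \<notin> K \<Longrightarrow> \<phi> x = 0"
    "\<And>x i. x \<notin> K \<Longrightarrow> partial_deriv i \<phi> x = 0"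
proof -
  let ?K = "closure {x. \<phi> x \<noteq> 0}"
  have K: "compact ?K" "?K \<subseteq> \<Omega>" using assms unfolding test_functions_def by auto
  have z: "\<phi> x = 0" if "x \<notin> ?K" for x
    using that closure_subset[of "{x. \<phi> x \<noteq> 0}"] by auto
  show ?thesis by (rule that[OF K z partial_deriv_eq_0[OF closed_closure z]])
qed

text \<open>The rescaled building blocks converge to the indicator of the open half-line, so products of them
  converge to the indicator of an open box.\<close>

lemma bump_scale_tendsto: "(\<lambda>m. bump (real (Suc m) * x)) \<longlonglongrightarrow> (if x > 0 then 1 else 0)"
proof (cases "x > 0")
  case True
  have "(\<lambda>m. exp (- (inverse (real (Suc m)) * inverse x))) \<longlonglongrightarrow> exp (- (0 * inverse x))"
    by (intro tendsto_intros LIMSEQ_inverse_real_of_nat)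
  then show ?thesis using True
    by (simp add: bump_def zero_less_mult_iff divide_inverse del: of_nat_Suc)
next
  case False
  then show ?thesis by (simp add: bump_eq_0 mult_nonneg_nonpos)
qed

lemma box_test_function:
  fixes a b :: "real^'n"
  assumes c: "c > 0"
  shows "(\<lambda>x. of_real (\<Prod>i\<in>UNIV. bump (c * (x $ i - a $ i)) * bump (c * (b $ i - x $ i)))) \<in> test_functions UNIV"
proof (rule test_functionsI)
  let ?\<psi> = "\<lambda>x::real^'n. \<Prod>i\<in>UNIV. bump (c * (x $ i - a $ i)) * bump (c * (b $ i - x $ i))"
  have lin: "Ck_on k UNIV (\<lambda>x::real^'n. x $ i)" for k i
    by (intro Ck_on_bounded_linear bounded_linear_vec_nth open_UNIV)
  have "Ck_on k UNIV (\<lambda>x. x $ i + (- a $ i))" "Ck_on k UNIV (\<lambda>x. (- 1) * x $ i + b $ i)" for k i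
    by (intro Ck_on_add Ck_on_mult Ck_on_const lin open_UNIV)+
  then have "Ck_on k UNIV (\<lambda>x. x $ i - a $ i)" "Ck_on k UNIV (\<lambda>x. b $ i - x $ i)" for k i
    by simp_all
  then have "Ck_on k UNIV (\<lambda>x. c * (x $ i - a $ i))" "Ck_on k UNIV (\<lambda>x. c * (b $ i - x $ i))" for k i
    using Ck_on_mult[OF open_UNIV Ck_on_const[OF open_UNIV]] by blast+
  note lin' = this
  have "Ck_on k UNIV (\<lambda>x. bump (c * (x $ i - a $ i)) * bump (c * (b $ i - x $ i)))" for k i
    by (rule Ck_on_mult[OF open_UNIV Ck_on_bump[OF open_UNIV lin'(1)] Ck_on_bump[OF open_UNIV lin'(2)]])
  then have "Ck_on k UNIV ?\<psi>" for k
    by (intro Ck_on_prod[OF open_UNIV]) auto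
  then have "Ck_on k UNIV (\<lambda>x. complex_of_real (?\<psi> x))" for k
    by (rule Ck_on_bounded_linear_compose[OF bounded_linear_of_real open_UNIV])
  then show "Ck k (\<lambda>x. complex_of_real (?\<psi> x))" for k
    using Ck_on_UNIV by blast
  show "compact (cbox a b)" by simp
  show "complex_of_real (?\<psi> x) = 0" if "x \<notin> cbox a b" for x
  proof -
    obtain i where "x $ i \<le> a $ i \<or> b $ i \<le> x $ i"
      using \<open>x \<notin> cbox a b\<close> by (auto simp: mem_box_cart not_le intro: less_imp_le)
    then have "bump (c * (x $ i - a $ i)) * bump (c * (b $ i - x $ i)) = 0"
      using c by (auto simp: bump_eq_0 mult_le_0_iff)
    then have "?\<psi> x = 0" by (intro prod_zero) auto
    then show ?thesis by simp
  qed
qed auto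

text \<open>The fundamental lemma of the calculus of variations.  Test functions supported in a closed box
  converge boundedly to the indicator of the open box.\<close>

lemma AE_eq_0_if_test_integrals_eq_0:
  fixes f :: "real^'n \<Rightarrow> complex"
  assumes f: "locally_integrable f"
    and z: "\<And>\<phi>. \<phi> \<in> test_functions UNIV \<Longrightarrow> (LINT x|lebesgue. f x * \<phi> x) = 0"
  shows "AE x in lebesgue. f x = 0"
proof -
  have fm[measurable]: "f \<in> borel_measurable lebesgue" using f by (rule locally_integrable_measurable)
  have ci: "integrable lebesgue (\<lambda>x. indicator (cbox a b) x *\<^sub>R f x)" for a b
    using f compact_cbox unfolding locally_integrable_def set_integrable_def by blast
  have bm: "(\<lambda>x. indicator (box a b) x *\<^sub>R f x) \<in> borel_measurable lebesgue" for a b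
    by (intro borel_measurable_scaleR borel_measurable_indicator fm) simp
  have bi: "integrable lebesgue (\<lambda>x. indicator (box a b) x *\<^sub>R f x)" for a b
  proof (rule Bochner_Integration.integrable_bound[OF ci[of a b]])
    show "AE x in lebesgue. norm (indicator (box a b) x *\<^sub>R f x) \<le> norm (indicator (cbox a b) x *\<^sub>R f x)"
      using box_subset_cbox[of a b] by (auto simp: indicator_def)
  qed (rule bm)
  have "(LINT x|lebesgue. indicator (box a b) x *\<^sub>R f x) = 0" for a b
  proof -
    define \<psi> where "\<psi> m x = (\<Prod>i\<in>UNIV. bump (real (Suc m) * (x $ i - a $ i)) * bump (real (Suc m) * (b $ i - x $ i)))"
      for m and x :: "real^'n"
    have t: "(\<lambda>x. of_real (\<psi> m x)) \<in> test_functions UNIV" for m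
      unfolding \<psi>_def by (rule box_test_function) simp
    have [measurable]: "(\<lambda>x. complex_of_real (\<psi> m x)) \<in> borel_measurable lebesgue" for m
      using locally_integrable_measurable[OF locally_integrable_continuous[OF test_functions_continuous[OF t]]] .
    have "(\<lambda>m. LINT x|lebesgue. f x * of_real (\<psi> m x)) \<longlonglongrightarrow> (LINT x|lebesgue. indicator (box a b) x *\<^sub>R f x)"
    proof (rule integral_dominated_convergence)
      show "integrable lebesgue (\<lambda>x. norm (indicator (cbox a b) x *\<^sub>R f x))"
        using ci by (rule integrable_norm)
      have "(\<lambda>m. \<psi> m x) \<longlonglongrightarrow> indicator (box a b) x" for x
      proof -
        have "(\<lambda>m. \<psi> m x) \<longlonglongrightarrow> (\<Prod>i\<in>UNIV. (if x $ i - a $ i > 0 then 1 else 0) * (if b $ i - x $ i > 0 then 1 else 0))"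
          unfolding \<psi>_def by (intro tendsto_prod tendsto_mult bump_scale_tendsto)
        also have "(\<Prod>i\<in>UNIV. (if x $ i - a $ i > 0 then 1 else 0) * (if b $ i - x $ i > 0 then 1 else (0::real)))
            = indicator (box a b) x"
        proof (cases "x \<in> box a b")
          case True
          then show ?thesis by (auto simp: mem_box_cart)
        next
          case False
          then obtain i where "\<not> (a $ i < x $ i \<and> x $ i < b $ i)" by (auto simp: mem_box_cart)
          then show ?thesis using False by (auto intro!: prod_zero bexI[of _ i])
        qed
        finally show ?thesis .
      qed
      then have "(\<lambda>m. f x * of_real (\<psi> m x)) \<longlonglongrightarrow> f x * of_real (indicator (box a b) x)" for x
        by (intro tendsto_intros)
      then show "AE x in lebesgue. (\<lambda>m. f x * of_real (\<psi> m x)) \<longlonglongrightarrow> indicator (box a b) x *\<^sub>R f x"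
        by (simp add: scaleR_conv_of_real mult.commute)
      show "AE x in lebesgue. norm (f x * of_real (\<psi> m x)) \<le> norm (indicator (cbox a b) x *\<^sub>R f x)" for m
      proof (rule AE_I2)
        fix x
        have "0 \<le> \<psi> m x" "\<psi> m x \<le> 1"
          unfolding \<psi>_def by (auto intro!: prod_nonneg prod_le_1 mult_le_one bump_nonneg bump_le_1 mult_nonneg_nonneg)
        moreover have "\<psi> m x = 0" if out: "x \<notin> cbox a b"
        proof -
          obtain i where "x $ i \<le> a $ i \<or> b $ i \<le> x $ i"
            using out by (auto simp: mem_box_cart not_le intro: less_imp_le)
          then have "bump (real (Suc m) * (x $ i - a $ i)) * bump (real (Suc m) * (b $ i - x $ i)) = 0"
            by (auto simp: bump_eq_0 mult_le_0_iff)
          then show ?thesis unfolding \<psi>_def by (intro prod_zero) auto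
        qed
        ultimately show "norm (f x * of_real (\<psi> m x)) \<le> norm (indicator (cbox a b) x *\<^sub>R f x)"
          by (cases "x \<in> cbox a b") (auto simp: norm_mult mult_left_le)
      qed
    qed (use bm in auto)
    then show ?thesis unfolding z[OF t] by (simp only: LIMSEQ_const_iff)
  qed
  note zero = this
  have "AE x in lebesgue. Re (f x) = 0"
  proof (rule AE_eq_0_if_box_integrals_eq_0)
    fix a b
    show "integrable lebesgue (\<lambda>x. indicator (box a b) x *\<^sub>R Re (f x))"
      using integrable_Re[OF bi[of a b]] by simp
    show "(LINT x|lebesgue. indicator (box a b) x *\<^sub>R Re (f x)) = 0"
      using integral_Re[OF bi[of a b]] zero[of a b] by simp
  qed measurable
  moreover have "AE x in lebesgue. Im (f x) = 0"
  proof (rule AE_eq_0_if_box_integrals_eq_0)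
    fix a b
    show "integrable lebesgue (\<lambda>x. indicator (box a b) x *\<^sub>R Im (f x))"
      using integrable_Im[OF bi[of a b]] by simp
    show "(LINT x|lebesgue. indicator (box a b) x *\<^sub>R Im (f x)) = 0"
      using integral_Im[OF bi[of a b]] zero[of a b] by simp
  qed measurable
  ultimately show ?thesis by eventually_elim (simp add: complex_eq_iff)
qed

section \<open>Weak gradients\<close>

lemma locally_integrable_component:
  fixes g :: "'a::euclidean_space \<Rightarrow> complex^'n"
  assumes "locally_integrable g"
  shows "locally_integrable (\<lambda>x. g x $ i)"
  unfolding locally_integrable_def set_integrable_def
proof (intro allI impI)
  fix K :: "'a set" assume "compact K"
  then have "integrable lebesgue (\<lambda>x. indicator K x *\<^sub>R g x)"
    using assms unfolding locally_integrable_def set_integrable_def by blast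
  from integrable_bounded_linear[OF bounded_linear_vec_nth this, of i]
  show "integrable lebesgue (\<lambda>x. indicator K x *\<^sub>R g x $ i)" by simp
qed

lemma locally_integrable_diff:
  fixes f g :: "'a::euclidean_space \<Rightarrow> 'b::euclidean_space"
  assumes "locally_integrable f" "locally_integrable g"
  shows "locally_integrable (\<lambda>x. f x - g x)"
  using assms unfolding locally_integrable_def by (auto intro: set_integral_diff(1))

lemma locally_integrable_mult_test:
  assumes "locally_integrable f" "\<phi> \<in> test_functions \<Omega>"
  shows "integrable lebesgue (\<lambda>x. f x * \<phi> x)" "integrable lebesgue (\<lambda>x. f x * partial_deriv i \<phi> x)"
proof -
  obtain K where "compact K" "\<And>x. x \<notin> K \<Longrightarrow> \<phi> x = 0" "\<And>x i. x \<notin> K \<Longrightarrow> partial_deriv i \<phi> x = 0"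
    using test_functions_support[OF assms(2)] by metis
  then show "integrable lebesgue (\<lambda>x. f x * \<phi> x)" "integrable lebesgue (\<lambda>x. f x * partial_deriv i \<phi> x)"
    using assms test_functions_continuous continuous_partial_deriv by (auto intro!: locally_integrable_mult)
qed

lemma has_weak_gradientD:
  assumes "has_weak_gradient u g" "\<phi> \<in> test_functions UNIV"
  shows "(LINT x|lebesgue. u x * partial_deriv i \<phi> x) = - (LINT x|lebesgue. g x $ i * \<phi> x)"
  using assms unfolding has_weak_gradient_def by blast

lemma has_weak_gradient_unique:
  assumes "has_weak_gradient u g" "has_weak_gradient u g'"
  shows "AE x in lebesgue. g x = g' x"
proof -
  have "AE x in lebesgue. g x $ i - g' x $ i = 0" for i
  proof (rule AE_eq_0_if_test_integrals_eq_0)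
    have l: "locally_integrable (\<lambda>x. g x $ i)" "locally_integrable (\<lambda>x. g' x $ i)"
      using assms locally_integrable_component unfolding has_weak_gradient_def by blast+
    then show "locally_integrable (\<lambda>x. g x $ i - g' x $ i)" by (rule locally_integrable_diff)
    fix \<phi> :: "real^'a \<Rightarrow> complex" assume t: "\<phi> \<in> test_functions UNIV"
    have "- (LINT x|lebesgue. g x $ i * \<phi> x) = - (LINT x|lebesgue. g' x $ i * \<phi> x)"
      unfolding has_weak_gradientD[OF assms(1) t, symmetric]
      by (rule has_weak_gradientD[OF assms(2) t])
    then show "(LINT x|lebesgue. (g x $ i - g' x $ i) * \<phi> x) = 0"
      using locally_integrable_mult_test(1)[OF l(1) t] locally_integrable_mult_test(1)[OF l(2) t]
      by (simp add: left_diff_distrib)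
  qed
  then have "AE x in lebesgue. \<forall>i. g x $ i - g' x $ i = 0"
    by (intro eventually_all_finite) auto
  then show ?thesis by eventually_elim (simp add: vec_eq_iff)
qed

lemma has_weak_gradient_weak_gradient:
  "has_weak_gradient u g \<Longrightarrow> has_weak_gradient u (weak_gradient u)"
  unfolding weak_gradient_def by (rule someI[of "has_weak_gradient u"])

text \<open>Uniqueness makes the chosen representative harmless: it may be replaced under integrals by any
  weak gradient that is at hand.\<close>

lemma weak_gradient_AE_eq:
  assumes "has_weak_gradient u g"
  shows "AE x in lebesgue. weak_gradient u x = g x"
  by (rule has_weak_gradient_unique[OF has_weak_gradient_weak_gradient[OF assms] assms])

lemma has_weak_gradient_diff:
  assumes u: "has_weak_gradient u g" and v: "has_weak_gradient v h"
  shows "has_weak_gradient (\<lambda>x. u x - v x) (\<lambda>x. g x - h x)"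
  unfolding has_weak_gradient_def
proof (intro conjI ballI allI)
  have l: "locally_integrable u" "locally_integrable v" "locally_integrable g" "locally_integrable h"
    using u v unfolding has_weak_gradient_def by auto
  then show "locally_integrable (\<lambda>x. u x - v x)" "locally_integrable (\<lambda>x. g x - h x)"
    by (auto intro: locally_integrable_diff)
  fix \<phi> :: "real^'a \<Rightarrow> complex" and i assume t: "\<phi> \<in> test_functions UNIV"
  show "(LINT x|lebesgue. (u x - v x) * partial_deriv i \<phi> x) = - (LINT x|lebesgue. (g x - h x) $ i * \<phi> x)"
    using locally_integrable_mult_test(2)[OF l(1) t] locally_integrable_mult_test(2)[OF l(2) t]
      locally_integrable_mult_test(1)[OF locally_integrable_component[OF l(3)] t]
      locally_integrable_mult_test(1)[OF locally_integrable_component[OF l(4)] t]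
    by (simp add: left_diff_distrib has_weak_gradientD[OF u t] has_weak_gradientD[OF v t])
qed

text \<open>The classical gradient.\<close>

definition gradient :: "(real^'n \<Rightarrow> complex) \<Rightarrow> real^'n \<Rightarrow> complex^'n" where
  "gradient \<phi> x = (\<chi> i. partial_deriv i \<phi> x)"

lemma continuous_gradient:
  "\<phi> \<in> test_functions \<Omega> \<Longrightarrow> continuous_on UNIV (gradient \<phi>)"
  unfolding gradient_def using continuous_partial_deriv by (intro continuous_on_vec_lambda)

lemma has_weak_gradient_test:
  assumes t: "\<phi> \<in> test_functions \<Omega>"
  shows "has_weak_gradient \<phi> (gradient \<phi>)"
  unfolding has_weak_gradient_def
proof (intro conjI ballI allI)
  show l: "locally_integrable \<phi>" "locally_integrable (gradient \<phi>)"
    using locally_integrable_continuous test_functions_continuous[OF t] continuous_gradient[OF t] by auto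
  fix \<psi> :: "real^'a \<Rightarrow> complex" and i assume s: "\<psi> \<in> test_functions UNIV"
  obtain K where K: "compact K" "\<And>x. x \<notin> K \<Longrightarrow> \<psi> x = 0"
    using test_functions_support[OF s] by metis
  have c: "continuous_on UNIV (\<lambda>x. \<phi> x * partial_deriv i \<psi> x + partial_deriv i \<phi> x * \<psi> x)"
    by (intro continuous_intros test_functions_continuous[OF s] test_functions_continuous[OF t]
        continuous_partial_deriv[OF s] continuous_partial_deriv[OF t])
  have "(LINT x|lborel. \<phi> x * frechet_derivative \<psi> (at x) (axis i 1)
       + frechet_derivative \<phi> (at x) (axis i 1) * \<psi> x) = 0"
    by (rule integral_directional_derivative_eq_0[where f = "\<lambda>x. \<phi> x * \<psi> x" and K = K
          and f' = "\<lambda>x v. \<phi> x * frechet_derivative \<psi> (at x) v + frechet_derivative \<phi> (at x) v * \<psi> x"])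
      (use c K has_derivative_mult[OF test_functions_derivative[OF t] test_functions_derivative[OF s]]
        in \<open>auto simp: partial_deriv_def\<close>)
  then have "(LINT x|lborel. \<phi> x * partial_deriv i \<psi> x + partial_deriv i \<phi> x * \<psi> x) = 0"
    by (simp add: partial_deriv_def)
  moreover have "(LINT x|lebesgue. \<phi> x * partial_deriv i \<psi> x + partial_deriv i \<phi> x * \<psi> x)
      = (LINT x|lborel. \<phi> x * partial_deriv i \<psi> x + partial_deriv i \<phi> x * \<psi> x)"
    by (rule integral_completion) (use c in \<open>simp add: borel_measurable_continuous_onI\<close>)
  ultimately have "(LINT x|lebesgue. \<phi> x * partial_deriv i \<psi> x + gradient \<phi> x $ i * \<psi> x) = 0"
    by (simp add: gradient_def)
  then show "(LINT x|lebesgue. \<phi> x * partial_deriv i \<psi> x) = - (LINT x|lebesgue. gradient \<phi> x $ i * \<psi> x)"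
    using locally_integrable_mult_test(2)[OF l(1) s]
      locally_integrable_mult_test(1)[OF locally_integrable_component[OF l(2)] s]
    by (simp add: eq_neg_iff_add_eq_0)
qed

lemma square_integrable_compact_support:
  fixes f :: "'a::euclidean_space \<Rightarrow> 'b::euclidean_space"
  assumes "continuous_on UNIV f" "compact K" "\<And>x. x \<notin> K \<Longrightarrow> f x = 0"
  shows "square_integrable f"
  unfolding square_integrable_def
proof
  show "f \<in> borel_measurable lebesgue"
    using locally_integrable_measurable locally_integrable_continuous assms(1) by blast
  have "integrable lborel (\<lambda>x. (norm (f x))\<^sup>2)"
    by (rule integrable_continuous_on_compact[OF assms(2)])
      (use assms in \<open>auto intro!: continuous_intros intro: continuous_on_subset\<close>)
  then show "integrable lebesgue (\<lambda>x. (norm (f x))\<^sup>2)"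
    by (subst integrable_completion) auto
qed

lemma square_integrable_test:
  assumes t: "\<phi> \<in> test_functions \<Omega>"
  shows "square_integrable \<phi>" "square_integrable (gradient \<phi>)"
proof -
  obtain K where K: "compact K" "\<And>x. x \<notin> K \<Longrightarrow> \<phi> x = 0" "\<And>x i. x \<notin> K \<Longrightarrow> partial_deriv i \<phi> x = 0"
    using test_functions_support[OF t] by metis
  show "square_integrable \<phi>" "square_integrable (gradient \<phi>)"
    using K test_functions_continuous[OF t] continuous_gradient[OF t]
    by (auto intro!: square_integrable_compact_support[where K = K] simp: gradient_def vec_eq_iff)
qed

text \<open>The point is that \<open>H1_norm\<close> vanishes at the zero function, whose chosen weak gradient is zero
  only almost everywhere.\<close>

lemma test_functions_subset_H1_0:
  assumes t: "\<phi> \<in> test_functions \<Omega>"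
  shows "\<phi> \<in> H1_0 \<Omega>"
proof -
  have "\<phi> \<in> H1" unfolding H1_def using square_integrable_test[OF t] has_weak_gradient_test[OF t] by auto
  moreover have "H1_norm (\<lambda>x. \<phi> x - \<phi> x) = 0"
  proof -
    have "has_weak_gradient (\<lambda>x. \<phi> x - \<phi> x) (\<lambda>x. gradient \<phi> x - gradient \<phi> x)"
      using has_weak_gradient_diff has_weak_gradient_test[OF t] by blast
    from weak_gradient_AE_eq[OF this]
    have "AE x in lebesgue. (norm (weak_gradient (\<lambda>x. \<phi> x - \<phi> x) x))\<^sup>2 = 0" by eventually_elim simp
    then have "(LINT x|lebesgue. (norm (weak_gradient (\<lambda>x. \<phi> x - \<phi> x) x))\<^sup>2) = 0"
      by (rule integral_eq_zero_AE)
    then show ?thesis unfolding H1_norm_def by simp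
  qed
  ultimately show ?thesis unfolding H1_0_def using t by (auto intro!: bexI[of _ \<phi>])
qed

lemma dirichlet_energy_eq:
  assumes "has_weak_gradient u g"
  shows "dirichlet_energy u = (\<integral>\<^sup>+x. ennreal ((norm (g x))\<^sup>2) \<partial>lebesgue)"
  unfolding dirichlet_energy_def
  by (rule nn_integral_cong_AE) (use weak_gradient_AE_eq[OF assms] in \<open>auto elim: eventually_mono\<close>)

section \<open>Hardy's inequality for test functions\<close>

text \<open>The potential \<open>\<Sum>\<^bsub>i<j\<^esub> 1 / r\<^bsub>ij\<^esub>\<^sup>2\<close>.  Since \<open>1 / 0 = 0\<close>, it is a real number also at collisions.\<close>

definition hardy_weight :: "real^'n::{finite,linorder} \<Rightarrow> real" where
  "hardy_weight x = (\<Sum>(i, j)\<in>{(i, j). i < j}. 1 / \<bar>x $ i - x $ j\<bar>\<^sup>2)"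

lemma hardy_weight_nonneg: "hardy_weight x \<ge> 0"
  unfolding hardy_weight_def by (intro sum_nonneg) auto

text \<open>The diagonal terms are \<open>1 / 0 = 0\<close> and may be included.\<close>

lemma hardy_weight_symmetric:
  fixes x :: "real^'n::{finite,linorder}"
  shows "(\<Sum>i\<in>UNIV. \<Sum>j\<in>UNIV. (1 / (x $ i - x $ j))\<^sup>2) = 2 * hardy_weight x"
proof -
  let ?f = "\<lambda>(i::'n, j). (1 / (x $ i - x $ j))\<^sup>2"
  let ?U = "{(i::'n, j). i < j}" and ?L = "{(i::'n, j). j < i}" and ?D = "{(i::'n, j). i = j}"
  have "(\<Sum>i\<in>UNIV. \<Sum>j\<in>UNIV. (1 / (x $ i - x $ j))\<^sup>2) = sum ?f UNIV"
    by (simp add: sum.cartesian_product)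
  also have "UNIV = ?U \<union> ?L \<union> ?D" by auto
  also have "sum ?f (?U \<union> ?L \<union> ?D) = sum ?f ?U + sum ?f ?L + sum ?f ?D"
    by (subst sum.union_disjoint, simp, simp, force)+ simp
  also have "sum ?f ?D = 0" by (intro sum.neutral) auto
  also have "sum ?f ?L = sum ?f ?U"
    by (rule sum.reindex_bij_witness[of _ prod.swap prod.swap]) (auto simp: power2_commute power_divide)
  also have "sum ?f ?U = hardy_weight x"
    unfolding hardy_weight_def by (intro sum.cong) (auto simp: power_divide)
  finally show ?thesis by simp
qed

text \<open>After expanding the square on the left, the mixed terms cancel because
  \<open>1/((a-b)(a-c)) + 1/((b-c)(b-a)) + 1/((c-a)(c-b)) = 0\<close> for distinct \<open>a, b, c\<close>.  Equivalently, the
  Vandermonde product is harmonic.  The triple sum is averaged over the cyclic permutations of the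
  summation indices.\<close>

lemma reciprocal_sum_square:
  fixes x :: "real^'n::{finite,linorder}"
  assumes x: "x \<notin> collision_set"
  shows "(\<Sum>i\<in>UNIV. (\<Sum>j\<in>UNIV. 1 / (x $ i - x $ j))\<^sup>2) = 2 * hardy_weight x"
proof -
  define q where "q i j = 1 / (x $ i - x $ j)" for i j
  have ne: "x $ i \<noteq> x $ j" if "i \<noteq> j" for i j using x that by (auto simp: collision_set_def)
  have q0: "q i i = 0" for i by (simp add: q_def)
  let ?f = "\<lambda>i j k. q i j * q i k"
  let ?T = "\<Sum>i\<in>UNIV. \<Sum>j\<in>UNIV. \<Sum>k\<in>UNIV. ?f i j k"
  let ?S = "\<Sum>i\<in>UNIV. \<Sum>j\<in>UNIV. (q i j)\<^sup>2"
  have rot: "(\<Sum>i\<in>UNIV. \<Sum>j\<in>UNIV. \<Sum>k\<in>UNIV. g j k i) = (\<Sum>i\<in>UNIV. \<Sum>j\<in>UNIV. \<Sum>k\<in>UNIV. g i j k)"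
    for g :: "'n \<Rightarrow> 'n \<Rightarrow> 'n \<Rightarrow> real"
  proof -
    have "(\<Sum>i\<in>UNIV. \<Sum>j\<in>UNIV. \<Sum>k\<in>UNIV. g j k i) = (\<Sum>j\<in>UNIV. \<Sum>i\<in>UNIV. \<Sum>k\<in>UNIV. g j k i)"
      by (rule sum.swap)
    also have "\<dots> = (\<Sum>j\<in>UNIV. \<Sum>k\<in>UNIV. \<Sum>i\<in>UNIV. g j k i)"
      by (intro sum.cong refl sum.swap)
    finally show ?thesis .
  qed
  \<comment> \<open>Since \<open>q i i = 0\<close>, a triple with two equal indices contributes one square, a triple of distinct indices nothing.\<close>
  have pt: "?f i j k + ?f j k i + ?f k i j = (if k = j then (q i j)\<^sup>2 else 0)
      + (if i = k then (q j k)\<^sup>2 else 0) + (if j = i then (q k i)\<^sup>2 else 0)" for i j k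
  proof (cases "i = j \<or> j = k \<or> i = k")
    case True
    then show ?thesis by (auto simp: q0 power2_eq_square)
  next
    case False
    then show ?thesis using ne[of i j] ne[of j k] ne[of i k]
      by (simp add: q_def divide_simps) (simp add: algebra_simps)
  qed
  have "3 * ?T = ?T + (\<Sum>i\<in>UNIV. \<Sum>j\<in>UNIV. \<Sum>k\<in>UNIV. ?f j k i) + (\<Sum>i\<in>UNIV. \<Sum>j\<in>UNIV. \<Sum>k\<in>UNIV. ?f k i j)"
    using rot[of ?f] rot[of "\<lambda>i j k. ?f j k i"] by simp
  also have "\<dots> = (\<Sum>i\<in>UNIV. \<Sum>j\<in>UNIV. \<Sum>k\<in>UNIV. ?f i j k + ?f j k i + ?f k i j)"
    by (simp only: sum.distrib)
  also have "\<dots> = (\<Sum>i\<in>UNIV. \<Sum>j\<in>UNIV. \<Sum>k\<in>UNIV. (if k = j then (q i j)\<^sup>2 else 0))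
     + (\<Sum>i\<in>UNIV. \<Sum>j\<in>UNIV. \<Sum>k\<in>UNIV. (if i = k then (q j k)\<^sup>2 else 0))
     + (\<Sum>i\<in>UNIV. \<Sum>j\<in>UNIV. \<Sum>k\<in>UNIV. (if j = i then (q k i)\<^sup>2 else 0))"
    unfolding pt by (simp only: sum.distrib)
  also have "(\<Sum>i\<in>UNIV. \<Sum>j\<in>UNIV. \<Sum>k\<in>UNIV. (if i = k then (q j k)\<^sup>2 else 0))
      = (\<Sum>i\<in>UNIV. \<Sum>j\<in>UNIV. \<Sum>k\<in>UNIV. (if k = j then (q i j)\<^sup>2 else 0))"
    using rot[of "\<lambda>i j k. if k = j then (q i j)\<^sup>2 else 0"] by simp
  also have "(\<Sum>i\<in>UNIV. \<Sum>j\<in>UNIV. \<Sum>k\<in>UNIV. (if j = i then (q k i)\<^sup>2 else 0))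
      = (\<Sum>i\<in>UNIV. \<Sum>j\<in>UNIV. \<Sum>k\<in>UNIV. (if k = j then (q i j)\<^sup>2 else 0))"
    using rot[of "\<lambda>i j k. if i = k then (q j k)\<^sup>2 else 0"] rot[of "\<lambda>i j k. if k = j then (q i j)\<^sup>2 else 0"] by simp
  also have "(\<Sum>i\<in>UNIV. \<Sum>j\<in>UNIV. \<Sum>k\<in>UNIV. (if k = j then (q i j)\<^sup>2 else 0)) = ?S"
    by simp
  finally have "?T = ?S" by simp
  moreover have "(\<Sum>i\<in>UNIV. (\<Sum>j\<in>UNIV. q i j)\<^sup>2) = ?T"
    by (simp add: power2_eq_square sum_product)
  ultimately show ?thesis using hardy_weight_symmetric[of x] by (simp add: q_def)
qed

lemma open_no_collision: "open (UNIV - collision_set :: (real^'n) set)"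
proof -
  have "collision_set = (\<Union>i. \<Union>j\<in>- {i}. {x::real^'n. x $ i = x $ j})"
    by (auto simp: collision_set_def) (metis ComplI singletonD)+
  moreover have "closed \<dots>"
    by (intro closed_UN ballI closed_Collect_eq continuous_intros finite)
  ultimately have "closed (collision_set :: (real^'n) set)" by simp
  then show ?thesis by (simp only: Compl_eq_Diff_UNIV[symmetric] open_Compl)
qed

lemma hardy_weight_measurable: "hardy_weight \<in> borel_measurable borel"
proof -
  have [measurable]: "(\<lambda>x::real^'n::{finite,linorder}. x $ i) \<in> borel_measurable borel" for i
    by (intro borel_measurable_continuous_onI continuous_intros)
  show ?thesis unfolding hardy_weight_def[abs_def] case_prod_beta by measurable
qed

lemma hardy_weight_continuous: "continuous_on (UNIV - collision_set) hardy_weight"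
  unfolding hardy_weight_def[abs_def] case_prod_beta
  by (intro continuous_intros) (auto simp: collision_set_def, metis less_irrefl)

lemma norm_diff_scaleR_square:
  fixes a b :: "'a::real_inner"
  shows "(norm (a - r *\<^sub>R b))\<^sup>2 = (norm a)\<^sup>2 - r * (2 * (b \<bullet> a)) + r\<^sup>2 * (norm b)\<^sup>2"
  unfolding power2_norm_eq_inner
  by (simp add: inner_diff_left inner_diff_right inner_commute power2_eq_square algebra_simps)

text \<open>With \<open>F\<^sub>i = 1/2 \<Sum>\<^sub>j 1/(x\<^sub>i - x\<^sub>j)\<close> one has \<open>\<Sum>\<^sub>i \<partial>\<^sub>i F\<^sub>i = - W\<close> and \<open>\<Sum>\<^sub>i F\<^sub>i\<^sup>2 = W / 2\<close> away from collisions, where \<open>W\<close> is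
  the potential.  Integrating \<open>\<bar>\<nabla>\<phi> - F \<phi>\<bar>\<^sup>2 \<ge> 0\<close> by parts gives the claim.\<close>

lemma hardy_inequality_test:
  fixes \<phi> :: "real^'n::{finite,linorder} \<Rightarrow> complex"
  assumes t: "\<phi> \<in> test_functions (UNIV - collision_set)"
  shows "(LINT x|lborel. (norm (\<phi> x))\<^sup>2 * hardy_weight x) \<le> 2 * (LINT x|lborel. (norm (gradient \<phi> x))\<^sup>2)"
    and "integrable lborel (\<lambda>x. (norm (\<phi> x))\<^sup>2 * hardy_weight x)"
    and "integrable lborel (\<lambda>x. (norm (gradient \<phi> x))\<^sup>2)"
proof -
  let ?\<Omega> = "UNIV - collision_set :: (real^'n::{finite,linorder}) set"
  obtain K where K: "compact K" "K \<subseteq> ?\<Omega>" and z: "\<And>x. x \<notin> K \<Longrightarrow> \<phi> x = 0"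
    and dz: "\<And>x i. x \<notin> K \<Longrightarrow> partial_deriv i \<phi> x = 0"
    using test_functions_support[OF t] by metis
  define q where "q x i j = 1 / (x $ i - x $ j)" for x :: "real^'n::{finite,linorder}" and i j
  define F where "F i x = (1/2) * (\<Sum>j\<in>UNIV. q x i j)" for i x
  have ne: "x $ i \<noteq> x $ j" if "i \<noteq> j" "x \<in> ?\<Omega>" for x :: "real^'n::{finite,linorder}" and i j
    using that by (auto simp: collision_set_def)
  have qc: "continuous_on ?\<Omega> (\<lambda>x. q x i j)" for i j
  proof (cases "i = j")
    case False
    then show ?thesis unfolding q_def using ne by (intro continuous_intros) auto
  qed (simp add: q_def)
  have Fc: "continuous_on ?\<Omega> (F i)" for i
    unfolding F_def[abs_def] by (intro continuous_intros qc)
  have \<phi>c: "continuous_on S \<phi>" and dc: "continuous_on S (partial_deriv i \<phi>)" for i S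
    using test_functions_continuous[OF t] continuous_partial_deriv[OF t] continuous_on_subset by blast+
  note cts = continuous_on_subset[OF qc K(2)] continuous_on_subset[OF Fc K(2)] \<phi>c dc
    continuous_on_subset[OF hardy_weight_continuous K(2)]
  \<comment> \<open>The derivative of \<open>F\<^sub>i \<bar>\<phi>\<bar>\<^sup>2\<close> in the direction of the \<open>i\<close>-th coordinate; its integral vanishes.\<close>
  define D where "D i x = - (1/2) * (\<Sum>j\<in>UNIV. (q x i j)\<^sup>2) * (\<phi> x \<bullet> \<phi> x)
       + F i x * (2 * (\<phi> x \<bullet> partial_deriv i \<phi> x))" for i x
  have Dint: "integrable lborel (D i)" for i
    by (rule integrable_continuous_on_compact[OF K(1)])
      (auto simp: D_def[abs_def] z intro!: continuous_intros cts)
  have D0: "(LINT x|lborel. D i x) = 0" for i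
  proof -
    define f' where "f' x v = (1/2) * (\<Sum>j\<in>UNIV. - (v $ i - v $ j) * (q x i j)\<^sup>2) * (\<phi> x \<bullet> \<phi> x)
       + F i x * (2 * (\<phi> x \<bullet> frechet_derivative \<phi> (at x) v))" for x v
    have der: "((\<lambda>x. F i x * (\<phi> x \<bullet> \<phi> x)) has_derivative f' x) (at x)" for x
    proof (cases "x \<in> K")
      case True
      then have x: "x \<in> ?\<Omega>" using K by auto
      have qd: "((\<lambda>x. q x i j) has_derivative (\<lambda>v. - (v $ i - v $ j) * (q x i j)\<^sup>2)) (at x)" for j
      proof (cases "i = j")
        case False
        then show ?thesis unfolding q_def using ne[OF False x]
          by (auto intro!: derivative_eq_intros bounded_linear_imp_has_derivative bounded_linear_vec_nth
              simp: power2_eq_square divide_simps)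
      qed (simp add: q_def)
      have Fd: "(F i has_derivative (\<lambda>v. (1/2) * (\<Sum>j\<in>UNIV. - (v $ i - v $ j) * (q x i j)\<^sup>2))) (at x)"
        unfolding F_def[abs_def]
        by (intro has_derivative_mult_right has_derivative_sum qd)
      have id: "((\<lambda>x. \<phi> x \<bullet> \<phi> x) has_derivative (\<lambda>v. \<phi> x \<bullet> frechet_derivative \<phi> (at x) v
           + frechet_derivative \<phi> (at x) v \<bullet> \<phi> x)) (at x)"
        using has_derivative_inner[OF test_functions_derivative[OF t] test_functions_derivative[OF t]] .
      have "f' x = (\<lambda>v. F i x * (\<phi> x \<bullet> frechet_derivative \<phi> (at x) v
           + frechet_derivative \<phi> (at x) v \<bullet> \<phi> x) + (1/2) * (\<Sum>j\<in>UNIV. - (v $ i - v $ j) * (q x i j)\<^sup>2) * (\<phi> x \<bullet> \<phi> x))"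
        unfolding f'_def by (simp add: fun_eq_iff inner_commute)
      then show ?thesis using has_derivative_mult[OF Fd id] by simp
    next
      case False
      have "f' x = (\<lambda>_. 0)"
        unfolding f'_def using z[OF False] by simp
      moreover have "((\<lambda>x. F i x * (\<phi> x \<bullet> \<phi> x)) has_derivative (\<lambda>_. 0)) (at x)"
        by (rule has_derivative_transform_within_open[OF has_derivative_const, of "- K"])
          (use False z K compact_imp_closed in auto)
      ultimately show ?thesis by simp
    qed
    have f'D: "f' x (axis i 1) = D i x" for x
    proof -
      have "(\<Sum>j\<in>UNIV. - (axis i 1 $ i - axis i 1 $ j) * (q x i j)\<^sup>2) = (\<Sum>j\<in>UNIV. - ((q x i j)\<^sup>2))"
        by (intro sum.cong refl) (auto simp: axis_def q_def)
      then show ?thesis unfolding f'_def D_def partial_deriv_def by (simp only: sum_negf)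
    qed
    have "continuous_on (?\<Omega> \<union> - K) (D i)"
    proof (rule continuous_on_open_Un[OF open_no_collision])
      show "open (- K)" using K compact_imp_closed by auto
      show "continuous_on ?\<Omega> (D i)"
        unfolding D_def[abs_def] by (intro continuous_intros qc Fc \<phi>c dc)
      show "continuous_on (- K) (D i)"
        by (rule continuous_on_eq[OF continuous_on_const[of _ 0]]) (auto simp: D_def z)
    qed
    moreover have "?\<Omega> \<union> - K = UNIV" using K by auto
    ultimately have "continuous_on UNIV (\<lambda>x. f' x (axis i 1))" by (simp add: f'D[abs_def])
    from integral_directional_derivative_eq_0[OF der this K(1)]
    show ?thesis by (simp add: f'D z)
  qed
  have n2: "(norm (gradient \<phi> x))\<^sup>2 = (\<Sum>i\<in>UNIV. (norm (partial_deriv i \<phi> x))\<^sup>2)" for x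
    by (simp add: norm_vec_def L2_set_def gradient_def sum_nonneg)
  show iW: "integrable lborel (\<lambda>x. (norm (\<phi> x))\<^sup>2 * hardy_weight x)"
    by (rule integrable_continuous_on_compact[OF K(1)]) (auto simp: z intro!: continuous_intros cts)
  show iG: "integrable lborel (\<lambda>x. (norm (gradient \<phi> x))\<^sup>2)"
    unfolding n2
    by (rule integrable_continuous_on_compact[OF K(1)]) (auto simp: dz intro!: continuous_intros cts)
  have key: "0 \<le> (norm (gradient \<phi> x))\<^sup>2 - (1/2) * ((norm (\<phi> x))\<^sup>2 * hardy_weight x) - (\<Sum>i\<in>UNIV. D i x)" for x
  proof (cases "x \<in> K")
    case True
    then have x: "x \<notin> collision_set" using K by auto
    have "0 \<le> (\<Sum>i\<in>UNIV. (norm (partial_deriv i \<phi> x - F i x *\<^sub>R \<phi> x))\<^sup>2)"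
      by (intro sum_nonneg) auto
    also have "\<dots> = (\<Sum>i\<in>UNIV. (norm (partial_deriv i \<phi> x))\<^sup>2 - F i x * (2 * (\<phi> x \<bullet> partial_deriv i \<phi> x))
        + (F i x)\<^sup>2 * (norm (\<phi> x))\<^sup>2)"
      by (simp only: norm_diff_scaleR_square)
    also have "\<dots> = (norm (gradient \<phi> x))\<^sup>2 - (\<Sum>i\<in>UNIV. F i x * (2 * (\<phi> x \<bullet> partial_deriv i \<phi> x)))
        + (\<Sum>i\<in>UNIV. (F i x)\<^sup>2) * (norm (\<phi> x))\<^sup>2"
      by (simp add: n2 sum.distrib sum_subtractf sum_distrib_right)
    also have "(\<Sum>i\<in>UNIV. (F i x)\<^sup>2) = (1/2) * hardy_weight x"
      using reciprocal_sum_square[OF x]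
      by (simp add: F_def q_def power_mult_distrib power_divide sum_divide_distrib[symmetric])
    also have "(\<Sum>i\<in>UNIV. F i x * (2 * (\<phi> x \<bullet> partial_deriv i \<phi> x)))
        = (\<Sum>i\<in>UNIV. D i x) + (1/2) * (\<Sum>i\<in>UNIV. \<Sum>j\<in>UNIV. (q x i j)\<^sup>2) * (norm (\<phi> x))\<^sup>2"
      unfolding D_def by (simp add: sum.distrib sum_distrib_right sum_distrib_left power2_norm_eq_inner sum_negf sum_subtractf)
    also have "(\<Sum>i\<in>UNIV. \<Sum>j\<in>UNIV. (q x i j)\<^sup>2) = 2 * hardy_weight x"
      using hardy_weight_symmetric[of x] by (simp add: q_def)
    finally show ?thesis by (simp add: algebra_simps)
  qed (simp add: D_def z)
  have "0 \<le> (LINT x|lborel. (norm (gradient \<phi> x))\<^sup>2 - (1/2) * ((norm (\<phi> x))\<^sup>2 * hardy_weight x) - (\<Sum>i\<in>UNIV. D i x))"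
    by (intro integral_nonneg_AE AE_I2 key)
  also have "\<dots> = (LINT x|lborel. (norm (gradient \<phi> x))\<^sup>2) - (1/2) * (LINT x|lborel. (norm (\<phi> x))\<^sup>2 * hardy_weight x)"
    using iW iG Dint D0 by simp
  finally show "(LINT x|lborel. (norm (\<phi> x))\<^sup>2 * hardy_weight x) \<le> 2 * (LINT x|lborel. (norm (gradient \<phi> x))\<^sup>2)"
    by simp
qed

section \<open>Passage to \<open>H\<^sub>0\<^sup>1\<close>\<close>

lemma norm_add_square_le:
  fixes a b :: "'a::real_normed_vector"
  assumes "\<delta> > 0"
  shows "(norm (a + b))\<^sup>2 \<le> (1 + \<delta>) * (norm a)\<^sup>2 + (1 + 1 / \<delta>) * (norm b)\<^sup>2"
proof -
  have "(norm (a + b))\<^sup>2 \<le> (norm a + norm b)\<^sup>2"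
    by (intro power_mono norm_triangle_ineq) auto
  moreover have "0 \<le> (\<delta> * norm a - norm b)\<^sup>2 / \<delta>" using assms by simp
  moreover have "(\<delta> * norm a - norm b)\<^sup>2 / \<delta> = \<delta> * (norm a)\<^sup>2 - 2 * norm a * norm b + (norm b)\<^sup>2 / \<delta>"
    using assms by (simp add: power2_eq_square field_simps)
  ultimately show ?thesis by (simp add: power2_eq_square algebra_simps)
qed

lemma square_integrable_diff:
  assumes "square_integrable f" "square_integrable g"
  shows "square_integrable (\<lambda>x. f x - g x)"
  unfolding square_integrable_def
proof
  have [measurable]: "f \<in> borel_measurable lebesgue" "g \<in> borel_measurable lebesgue"
    using assms unfolding square_integrable_def by auto
  show "(\<lambda>x. f x - g x) \<in> borel_measurable lebesgue" by measurable
  show "integrable lebesgue (\<lambda>x. (norm (f x - g x))\<^sup>2)"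
  proof (rule Bochner_Integration.integrable_bound)
    show "integrable lebesgue (\<lambda>x. 2 * (norm (f x))\<^sup>2 + 2 * (norm (g x))\<^sup>2)"
      using assms unfolding square_integrable_def by auto
    show "(\<lambda>x. (norm (f x - g x))\<^sup>2) \<in> borel_measurable lebesgue" by measurable
    have "(norm (f x - g x))\<^sup>2 \<le> 2 * (norm (f x))\<^sup>2 + 2 * (norm (g x))\<^sup>2" for x
      using norm_add_square_le[of 1 "f x" "- g x"] by simp
    then show "AE x in lebesgue. norm ((norm (f x - g x))\<^sup>2) \<le> norm (2 * (norm (f x))\<^sup>2 + 2 * (norm (g x))\<^sup>2)"
      by (intro AE_I2) (auto intro: order_trans abs_ge_self)
  qed
qed

text \<open>The weight is truncated at \<open>m\<close>, so that the weighted integral is continuous with respect to the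
  \<open>L\<^sup>2\<close> norm and the inequality passes from test functions to their limits.\<close>

lemma hardy_inequality_truncated:
  fixes u :: "real^'n::{finite,linorder} \<Rightarrow> complex"
  assumes u: "u \<in> H1_0 (UNIV - collision_set)" and g: "has_weak_gradient u g" "square_integrable g"
    and m: "m \<ge> 0"
  shows "(LINT x|lebesgue. (norm (u x))\<^sup>2 * min (hardy_weight x) m) \<le> 2 * (LINT x|lebesgue. (norm (g x))\<^sup>2)"
    and "integrable lebesgue (\<lambda>x. (norm (u x))\<^sup>2 * min (hardy_weight x) m)"
proof -
  let ?w = "\<lambda>x::real^'n::{finite,linorder}. min (hardy_weight x) m"
  let ?E = "LINT x|lebesgue. (norm (g x))\<^sup>2"
  let ?A = "LINT x|lebesgue. (norm (u x))\<^sup>2 * ?w x"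
  have [measurable]: "hardy_weight \<in> borel_measurable lebesgue"
    using measurable_completion[of hardy_weight lborel borel] hardy_weight_measurable by simp
  have us: "square_integrable u" using u unfolding H1_0_def H1_def by auto
  have w: "0 \<le> ?w x" "?w x \<le> m" for x using m hardy_weight_nonneg[of x] by auto
  have int: "integrable lebesgue (\<lambda>x. (norm (f x))\<^sup>2 * ?w x)" if "square_integrable f" for f :: "real^'n::{finite,linorder} \<Rightarrow> complex"
  proof (rule Bochner_Integration.integrable_bound)
    show "integrable lebesgue (\<lambda>x. m * (norm (f x))\<^sup>2)"
      using that unfolding square_integrable_def by auto
    show "AE x in lebesgue. norm ((norm (f x))\<^sup>2 * ?w x) \<le> norm (m * (norm (f x))\<^sup>2)"
      using w m by (intro AE_I2) (auto simp: abs_mult mult.commute[of m] intro!: mult_left_mono)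
    have [measurable]: "f \<in> borel_measurable lebesgue" using that unfolding square_integrable_def by auto
    show "(\<lambda>x. (norm (f x))\<^sup>2 * ?w x) \<in> borel_measurable lebesgue" by measurable
  qed
  show "integrable lebesgue (\<lambda>x. (norm (u x))\<^sup>2 * ?w x)" using int[OF us] .
  \<comment> \<open>An approximation with error less than \<open>\<delta>\<close> is combined with the splitting
    \<open>\<bar>a + b\<bar>\<^sup>2 \<le> (1 + \<delta>) \<bar>a\<bar>\<^sup>2 + (1 + 1/\<delta>) \<bar>b\<bar>\<^sup>2\<close>; the error terms \<open>(1 + 1/\<delta>) \<delta>\<^sup>2 = \<delta>\<^sup>2 + \<delta>\<close> still tend to \<open>0\<close>.\<close>
  have bound: "?A \<le> 2 * (1 + \<delta>) * ((1 + \<delta>) * ?E + (\<delta>\<^sup>2 + \<delta>)) + m * (\<delta>\<^sup>2 + \<delta>)" if \<delta>: "\<delta> > 0" for \<delta>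
  proof -
    obtain \<phi> where t: "\<phi> \<in> test_functions (UNIV - collision_set)" and n: "H1_norm (\<lambda>x. u x - \<phi> x) < \<delta>"
      using u \<delta> unfolding H1_0_def by auto
    note ps = square_integrable_test[OF t]
    have ds: "square_integrable (\<lambda>x. u x - \<phi> x)" "square_integrable (\<lambda>x. g x - gradient \<phi> x)"
      using square_integrable_diff us g ps by auto
    have wg: "AE x in lebesgue. weak_gradient (\<lambda>x. u x - \<phi> x) x = g x - gradient \<phi> x"
      using weak_gradient_AE_eq[OF has_weak_gradient_diff[OF g(1) has_weak_gradient_test[OF t]]] .
    let ?d = "LINT x|lebesgue. (norm (u x - \<phi> x))\<^sup>2"
    let ?e = "LINT x|lebesgue. (norm (g x - gradient \<phi> x))\<^sup>2"
    let ?P = "LINT x|lebesgue. (norm (gradient \<phi> x))\<^sup>2"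
    have sd: "integrable lebesgue (\<lambda>x. (norm (u x - \<phi> x))\<^sup>2)"
       "integrable lebesgue (\<lambda>x. (norm (g x - gradient \<phi> x))\<^sup>2)"
       "integrable lebesgue (\<lambda>x. (norm (gradient \<phi> x))\<^sup>2)" "integrable lebesgue (\<lambda>x. (norm (g x))\<^sup>2)"
      using ds ps g unfolding square_integrable_def by auto
    have pos: "0 \<le> ?d" "0 \<le> ?e" by auto
    have "(LINT x|lebesgue. (norm (weak_gradient (\<lambda>x. u x - \<phi> x) x))\<^sup>2) = ?e"
    proof (rule integral_cong_AE)
      show "(\<lambda>x. (norm (g x - gradient \<phi> x))\<^sup>2) \<in> borel_measurable lebesgue" using sd by auto
      show ae: "AE x in lebesgue. (norm (weak_gradient (\<lambda>x. u x - \<phi> x) x))\<^sup>2 = (norm (g x - gradient \<phi> x))\<^sup>2"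
        using wg by eventually_elim simp
      show "(\<lambda>x. (norm (weak_gradient (\<lambda>x. u x - \<phi> x) x))\<^sup>2) \<in> borel_measurable lebesgue"
      proof -
        have "has_weak_gradient (\<lambda>x. u x - \<phi> x) (weak_gradient (\<lambda>x. u x - \<phi> x))"
          using has_weak_gradient_weak_gradient has_weak_gradient_diff[OF g(1) has_weak_gradient_test[OF t]] .
        then have [measurable]: "weak_gradient (\<lambda>x. u x - \<phi> x) \<in> borel_measurable lebesgue"
          unfolding has_weak_gradient_def using locally_integrable_measurable by blast
        show ?thesis by measurable
      qed
    qed
    then have "sqrt (?d + ?e) < \<delta>" using n unfolding H1_norm_def by simp
    then have "(sqrt (?d + ?e))\<^sup>2 < \<delta>\<^sup>2" using pos by (intro power_strict_mono) auto
    then have "?d + ?e < \<delta>\<^sup>2" using pos by simp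
    then have d: "?d \<le> \<delta>\<^sup>2" and e: "?e \<le> \<delta>\<^sup>2" using pos by linarith+
    have c: "(1 + 1 / \<delta>) * \<delta>\<^sup>2 = \<delta>\<^sup>2 + \<delta>" using \<delta> by (simp add: power2_eq_square field_simps)
    have "?P \<le> (LINT x|lebesgue. (1 + \<delta>) * (norm (g x))\<^sup>2 + (1 + 1 / \<delta>) * (norm (g x - gradient \<phi> x))\<^sup>2)"
    proof (rule integral_mono)
      show "(norm (gradient \<phi> x))\<^sup>2 \<le> (1 + \<delta>) * (norm (g x))\<^sup>2 + (1 + 1 / \<delta>) * (norm (g x - gradient \<phi> x))\<^sup>2" for x
        using norm_add_square_le[OF \<delta>, of "g x" "gradient \<phi> x - g x"] by (simp add: norm_minus_commute)
    qed (use sd in auto)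
    also have "\<dots> = (1 + \<delta>) * ?E + (1 + 1 / \<delta>) * ?e" using sd by simp
    also have "\<dots> \<le> (1 + \<delta>) * ?E + (1 + 1 / \<delta>) * \<delta>\<^sup>2"
      using e \<delta> by (intro add_left_mono mult_left_mono) auto
    finally have P: "?P \<le> (1 + \<delta>) * ?E + (\<delta>\<^sup>2 + \<delta>)" unfolding c .
    note hw = hardy_inequality_test[OF t]
    have hm: "(\<lambda>x. (norm (\<phi> x))\<^sup>2 * hardy_weight x) \<in> borel_measurable lborel"
      "(\<lambda>x. (norm (gradient \<phi> x))\<^sup>2) \<in> borel_measurable lborel" using hw by auto
    have "(LINT x|lebesgue. (norm (\<phi> x))\<^sup>2 * ?w x) \<le> (LINT x|lebesgue. (norm (\<phi> x))\<^sup>2 * hardy_weight x)"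
      by (rule integral_mono[OF int[OF ps(1)]])
        (use hw(2) integrable_completion[OF hm(1)] in \<open>auto intro: mult_left_mono\<close>)
    also have "\<dots> \<le> 2 * ?P"
      using hw(1) integral_completion[OF hm(1)] integral_completion[OF hm(2)] by simp
    finally have Q: "(LINT x|lebesgue. (norm (\<phi> x))\<^sup>2 * ?w x) \<le> 2 * ?P" .
    have "?A \<le> (LINT x|lebesgue. (1 + \<delta>) * ((norm (\<phi> x))\<^sup>2 * ?w x) + (1 + 1 / \<delta>) * (m * (norm (u x - \<phi> x))\<^sup>2))"
    proof (rule integral_mono[OF int[OF us]])
      show "integrable lebesgue (\<lambda>x. (1 + \<delta>) * ((norm (\<phi> x))\<^sup>2 * ?w x) + (1 + 1 / \<delta>) * (m * (norm (u x - \<phi> x))\<^sup>2))"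
        using int[OF ps(1)] sd by auto
      fix x
      have "(norm (u x))\<^sup>2 * ?w x \<le> ((1 + \<delta>) * (norm (\<phi> x))\<^sup>2 + (1 + 1 / \<delta>) * (norm (u x - \<phi> x))\<^sup>2) * ?w x"
        using norm_add_square_le[OF \<delta>, of "\<phi> x" "u x - \<phi> x"] w[of x] by (intro mult_right_mono) auto
      also have "\<dots> = (1 + \<delta>) * ((norm (\<phi> x))\<^sup>2 * ?w x) + (1 + 1 / \<delta>) * (?w x * (norm (u x - \<phi> x))\<^sup>2)"
        by (simp add: algebra_simps)
      also have "\<dots> \<le> (1 + \<delta>) * ((norm (\<phi> x))\<^sup>2 * ?w x) + (1 + 1 / \<delta>) * (m * (norm (u x - \<phi> x))\<^sup>2)"
        using w[of x] \<delta> by (intro add_left_mono mult_left_mono mult_right_mono) auto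
      finally show "(norm (u x))\<^sup>2 * ?w x \<le> (1 + \<delta>) * ((norm (\<phi> x))\<^sup>2 * ?w x) + (1 + 1 / \<delta>) * (m * (norm (u x - \<phi> x))\<^sup>2)" .
    qed
    also have "\<dots> = (1 + \<delta>) * (LINT x|lebesgue. (norm (\<phi> x))\<^sup>2 * ?w x) + (1 + 1 / \<delta>) * (m * ?d)"
      using int[OF ps(1)] sd by simp
    also have "\<dots> \<le> (1 + \<delta>) * (2 * ((1 + \<delta>) * ?E + (\<delta>\<^sup>2 + \<delta>))) + (1 + 1 / \<delta>) * (m * \<delta>\<^sup>2)"
      using P Q \<delta> m d by (intro add_mono mult_left_mono) auto
    also have "(1 + 1 / \<delta>) * (m * \<delta>\<^sup>2) = m * (\<delta>\<^sup>2 + \<delta>)" using c by (simp add: mult.left_commute)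
    finally show ?thesis by (simp add: algebra_simps)
  qed
  have "((\<lambda>\<delta>. 2 * (1 + \<delta>) * ((1 + \<delta>) * ?E + (\<delta>\<^sup>2 + \<delta>)) + m * (\<delta>\<^sup>2 + \<delta>)) \<longlongrightarrow>
      2 * (1 + 0) * ((1 + 0) * ?E + (0\<^sup>2 + 0)) + m * (0\<^sup>2 + 0)) (at_right 0)"
    by (intro tendsto_intros)
  then have "?A \<le> 2 * (1 + 0) * ((1 + 0) * ?E + (0\<^sup>2 + 0)) + m * (0\<^sup>2 + 0)"
    by (rule tendsto_lowerbound) (use bound in \<open>auto simp: eventually_at_filter\<close>)
  then show "?A \<le> 2 * ?E" by simp
qed

lemma hardy_inequality:
  fixes u :: "real^'n::{finite,linorder} \<Rightarrow> complex"
  assumes u: "u \<in> H1_0 (UNIV - collision_set)"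
  shows "ennreal (1/2) * hardy_integral u \<le> dirichlet_energy u"
proof -
  obtain g where g: "has_weak_gradient u g" "square_integrable g"
    using u unfolding H1_0_def H1_def by auto
  let ?E = "LINT x|lebesgue. (norm (g x))\<^sup>2"
  have de: "dirichlet_energy u = ennreal ?E"
    unfolding dirichlet_energy_eq[OF g(1)]
    by (rule nn_integral_eq_integral) (use g in \<open>auto simp: square_integrable_def\<close>)
  let ?f = "\<lambda>m x. ennreal ((norm (u x))\<^sup>2 * min (hardy_weight x) (real m))"
  have "hardy_integral u = (\<integral>\<^sup>+x. (SUP m. ?f m x) \<partial>lebesgue)"
    unfolding hardy_integral_def hardy_weight_def[symmetric]
  proof (rule nn_integral_cong)
    fix x
    show "ennreal ((norm (u x))\<^sup>2 * hardy_weight x) = (SUP m. ?f m x)"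
    proof (rule antisym)
      obtain m where "hardy_weight x \<le> real m" using real_arch_simple by blast
      then have "ennreal ((norm (u x))\<^sup>2 * hardy_weight x) = ?f m x" by simp
      then show "ennreal ((norm (u x))\<^sup>2 * hardy_weight x) \<le> (SUP m. ?f m x)"
        by (metis SUP_upper UNIV_I)
      show "(SUP m. ?f m x) \<le> ennreal ((norm (u x))\<^sup>2 * hardy_weight x)"
        by (intro SUP_least ennreal_leI mult_left_mono) auto
    qed
  qed
  also have "\<dots> = (SUP m. \<integral>\<^sup>+x. ?f m x \<partial>lebesgue)"
  proof (rule nn_integral_monotone_convergence_SUP)
    show "incseq (\<lambda>m. ?f m)"
      by (auto simp: incseq_def le_fun_def intro!: ennreal_leI mult_left_mono)
    show "?f m \<in> borel_measurable lebesgue" for m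
      using borel_measurable_integrable[OF hardy_inequality_truncated(2)[OF u g, of "real m"]] by simp
  qed
  also have "\<dots> \<le> ennreal (2 * ?E)"
  proof (rule SUP_least)
    fix m
    have "(\<integral>\<^sup>+x. ?f m x \<partial>lebesgue) = ennreal (LINT x|lebesgue. (norm (u x))\<^sup>2 * min (hardy_weight x) (real m))"
      by (rule nn_integral_eq_integral[OF hardy_inequality_truncated(2)[OF u g]])
        (auto simp: hardy_weight_nonneg)
    also have "\<dots> \<le> ennreal (2 * ?E)"
      by (intro ennreal_leI hardy_inequality_truncated(1)[OF u g]) auto
    finally show "(\<integral>\<^sup>+x. ?f m x \<partial>lebesgue) \<le> ennreal (2 * ?E)" .
  qed
  finally have "ennreal (1/2) * hardy_integral u \<le> ennreal (1/2) * ennreal (2 * ?E)"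
    by (rule mult_left_mono) auto
  also have "\<dots> = ennreal ?E" by (subst ennreal_mult[symmetric]) auto
  finally show ?thesis using de by simp
qed

section \<open>Integrals of functions of one coordinate difference\<close>

lemma borel_measurable_component [measurable]:
  "(\<lambda>x::real^'n. x $ i) \<in> borel_measurable borel"
  by (intro borel_measurable_continuous_onI continuous_intros)

lemma bounded_linear_component_diff: "bounded_linear (\<lambda>x::real^'n. x $ i - x $ j)"
  by (intro bounded_linear_sub bounded_linear_vec_nth)

text \<open>If \<open>g\<close> does not depend on the coordinate \<open>x\<^sub>i\<close>, then integrating \<open>f(x\<^sub>i - x\<^sub>j) g(x)\<close> amounts to integrating
  \<open>f\<close> up to a factor.  This holds because the push-forward of \<open>g dx\<close> under \<open>x\<^sub>i - x\<^sub>j\<close> is translation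
  invariant.  The proof is the usual uniqueness argument for Haar measure: insert a function of
  integral \<open>1\<close>, exchange the integrals, and translate.\<close>

lemma nn_integral_component_diff:
  fixes f :: "real \<Rightarrow> ennreal" and g :: "real^'n \<Rightarrow> ennreal"
  assumes [measurable]: "f \<in> borel_measurable borel" "g \<in> borel_measurable borel"
    and inv: "\<And>x s. g (x + s *\<^sub>R axis i 1) = g x" and ij: "i \<noteq> j"
  shows "(\<integral>\<^sup>+x. f (x $ i - x $ j) * g x \<partial>lborel) =
    (\<integral>\<^sup>+s. f s \<partial>lborel) * (\<integral>\<^sup>+x. indicator {0..1} (x $ i - x $ j) * g x \<partial>lborel)"
proof -
  let ?q = "indicator {0..1} :: real \<Rightarrow> ennreal"
  let ?t = "\<lambda>x::real^'n. x $ i - x $ j"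
  have q: "(\<integral>\<^sup>+s. ?q (a - s) \<partial>lborel) = 1" for a
  proof -
    have "(\<integral>\<^sup>+s. ?q s \<partial>lborel) = ennreal \<bar>- 1\<bar> * (\<integral>\<^sup>+s. ?q (a + (- 1) * s) \<partial>lborel)"
      by (rule nn_integral_real_affine) auto
    then show ?thesis by simp
  qed
  have f: "(\<integral>\<^sup>+s. f (a + s) \<partial>lborel) = (\<integral>\<^sup>+s. f s \<partial>lborel)" for a
    using nn_integral_real_affine[of f 1 a] by simp
  have "(\<integral>\<^sup>+x. f (?t x) * g x \<partial>lborel) = (\<integral>\<^sup>+x. (\<integral>\<^sup>+s. f (?t x) * g x * ?q (?t x - s) \<partial>lborel) \<partial>lborel)"
    by (simp add: nn_integral_cmult q)
  also have "\<dots> = (\<integral>\<^sup>+s. (\<integral>\<^sup>+x. f (?t x) * g x * ?q (?t x - s) \<partial>lborel) \<partial>lborel)"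
    by (rule lborel_pair.Fubini'[symmetric]) measurable
  also have "\<dots> = (\<integral>\<^sup>+s. (\<integral>\<^sup>+x. f (?t x + s) * g x * ?q (?t x) \<partial>lborel) \<partial>lborel)"
  proof (rule nn_integral_cong)
    fix s :: real
    have shift: "?t (x + s *\<^sub>R axis i 1) = ?t x + s" for x
      using ij by (simp add: axis_def)
    show "(\<integral>\<^sup>+x. f (?t x) * g x * ?q (?t x - s) \<partial>lborel) = (\<integral>\<^sup>+x. f (?t x + s) * g x * ?q (?t x) \<partial>lborel)"
      using lborel_nn_integral_translate[of "\<lambda>x. f (?t x) * g x * ?q (?t x - s)" "s *\<^sub>R axis i 1"]
      by (simp only: inv shift add_diff_cancel_right') simp
  qed
  also have "\<dots> = (\<integral>\<^sup>+x. (\<integral>\<^sup>+s. f (?t x + s) * g x * ?q (?t x) \<partial>lborel) \<partial>lborel)"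
    by (rule lborel_pair.Fubini') measurable
  also have "\<dots> = (\<integral>\<^sup>+x. (\<integral>\<^sup>+s. f s \<partial>lborel) * (?q (?t x) * g x) \<partial>lborel)"
  proof (rule nn_integral_cong)
    fix x :: "real^'n"
    have "(\<integral>\<^sup>+s. f (?t x + s) * (g x * ?q (?t x)) \<partial>lborel) = (\<integral>\<^sup>+s. f s \<partial>lborel) * (g x * ?q (?t x))"
      by (simp add: nn_integral_multc f)
    then show "(\<integral>\<^sup>+s. f (?t x + s) * g x * ?q (?t x) \<partial>lborel) = (\<integral>\<^sup>+s. f s \<partial>lborel) * (?q (?t x) * g x)"
      by (simp only: mult.assoc mult.commute[of "?q (?t x)" "g x"])
  qed
  also have "\<dots> = (\<integral>\<^sup>+s. f s \<partial>lborel) * (\<integral>\<^sup>+x. ?q (?t x) * g x \<partial>lborel)"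
    by (rule nn_integral_cmult) measurable
  finally show ?thesis .
qed

lemma nn_integral_reciprocal:
  assumes "0 < a" "a \<le> b"
  shows "(\<integral>\<^sup>+s. ennreal (indicator {a..b} s / s) \<partial>lborel) = ennreal (ln b - ln a)"
proof -
  have "(\<integral>\<^sup>+s. ennreal (1 / s) * indicator {a..b} s \<partial>lborel) = ennreal (ln b - ln a)"
    by (rule nn_integral_FTC_Icc) (use assms in \<open>auto intro!: derivative_eq_intros\<close>)
  moreover have "ennreal (indicator {a..b} s / s) = ennreal (1 / s) * indicator {a..b} s" for s
    by (auto simp: indicator_def)
  ultimately show ?thesis by simp
qed

section \<open>The ground state representation\<close>

text \<open>The function \<open>sqrt t\<close>, where \<open>t = x\<^sub>i - x\<^sub>j\<close>, is the virtual ground state of the pair \<open>i, j\<close>.  Writing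
  \<open>u = sqrt t v\<close>, the mixed term in \<open>\<bar>\<nabla>u\<bar>\<^sup>2\<close> is half the derivative of \<open>v\<^sup>2\<close> in the direction
  \<open>e\<^sub>i - e\<^sub>j\<close>, whose integral vanishes.  Note that \<open>v\<^sup>2 / t = \<bar>u\<bar>\<^sup>2 / t\<^sup>2\<close>.\<close>

lemma ground_state_identity:
  fixes v :: "real^'n \<Rightarrow> real"
  assumes ij: "i \<noteq> j" and smooth: "Ck_on 1 UNIV v"
    and K: "compact K" "\<And>x. x \<in> K \<Longrightarrow> 0 < x $ i - x $ j" "\<And>x. x \<notin> K \<Longrightarrow> v x = 0"
    and u: "\<And>x. u x = complex_of_real (sqrt (x $ i - x $ j) * v x)"
  defines "d \<equiv> \<lambda>k x. frechet_derivative v (at x) (axis k 1)"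
  shows "integrable lborel (\<lambda>x. (x $ i - x $ j) * (\<Sum>k\<in>UNIV. (d k x)\<^sup>2))"
    and "integrable lborel (\<lambda>x. (v x)\<^sup>2 / (x $ i - x $ j))"
    and "(LINT x|lborel. (norm (gradient u x))\<^sup>2) =
      (LINT x|lborel. (x $ i - x $ j) * (\<Sum>k\<in>UNIV. (d k x)\<^sup>2))
      + 1/2 * (LINT x|lborel. (v x)\<^sup>2 / (x $ i - x $ j))"
proof -
  let ?t = "\<lambda>x::real^'n. x $ i - x $ j"
  let ?e = "axis i 1 - axis j 1 :: real^'n"
  have vd: "(v has_derivative frechet_derivative v (at x)) (at x)" for x
    using Ck_on_SucD(1)[of 0 UNIV v] smooth by simp
  have vc: "continuous_on S v" and dc: "continuous_on S (\<lambda>x. frechet_derivative v (at x) w)" for S w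
    using Ck_on_continuous[OF smooth] smooth continuous_on_subset[of UNIV _ S] by auto
  have clK: "closed K" using K compact_imp_closed by auto
  have dv0: "frechet_derivative v (at x) = (\<lambda>_. 0)" if "x \<notin> K" for x
    by (rule frechet_derivative_eq_0[of K v, OF clK K(3) that])
  show iA: "integrable lborel (\<lambda>x. ?t x * (\<Sum>k\<in>UNIV. (d k x)\<^sup>2))"
    by (rule integrable_continuous_on_compact[OF K(1)])
      (auto simp: d_def dv0 intro!: continuous_intros dc)
  show iB: "integrable lborel (\<lambda>x. (v x)\<^sup>2 / ?t x)"
    by (rule integrable_continuous_on_compact[OF K(1)])
      (use K in \<open>force intro!: continuous_intros vc\<close>)+
  let ?c = "\<lambda>x. v x * frechet_derivative v (at x) ?e"
  have iC: "integrable lborel ?c"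
    by (rule integrable_continuous_on_compact[OF K(1)]) (auto simp: K(3) intro!: continuous_intros vc dc)
  have C0: "(LINT x|lborel. ?c x) = 0"
  proof -
    have "(LINT x|lborel. v x * frechet_derivative v (at x) ?e + frechet_derivative v (at x) ?e * v x) = 0"
      by (rule integral_directional_derivative_eq_0[OF has_derivative_mult[OF vd vd] _ K(1)])
        (auto simp: K(3) intro!: continuous_intros vc dc)
    then have "(LINT x|lborel. ?c x + ?c x) = 0" by (simp add: mult.commute)
    then show ?thesis using iC by simp
  qed
  have pt: "(norm (gradient u x))\<^sup>2 = ?t x * (\<Sum>k\<in>UNIV. (d k x)\<^sup>2) + 1/2 * ((v x)\<^sup>2 / ?t x) + ?c x" for x
  proof (cases "x \<in> K")
    case True
    then have t: "?t x > 0" using K by auto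
    define s where "s k = (axis k 1 :: real^'n) $ i - axis k 1 $ j" for k
    have sq: "((\<lambda>x. sqrt (?t x)) has_derivative (\<lambda>w. (w $ i - w $ j) * (inverse (sqrt (?t x)) / 2))) (at x)"
      using DERIV_compose_FDERIV[OF DERIV_real_sqrt[OF t] bounded_linear_imp_has_derivative[OF bounded_linear_component_diff]]
      by simp
    have ud: "(u has_derivative (\<lambda>w. complex_of_real (sqrt (?t x) * frechet_derivative v (at x) w
         + (w $ i - w $ j) * (inverse (sqrt (?t x)) / 2) * v x))) (at x)"
      unfolding u[abs_def]
      by (rule bounded_linear.has_derivative[OF bounded_linear_of_real has_derivative_mult[OF sq vd]])
    have pd: "partial_deriv k u x = complex_of_real (sqrt (?t x) * d k x + s k * (inverse (sqrt (?t x)) / 2) * v x)" for k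
      unfolding partial_deriv_def d_def s_def frechet_derivative_at[OF ud, symmetric] ..
    have "(norm (gradient u x))\<^sup>2 = (\<Sum>k\<in>UNIV. (sqrt (?t x) * d k x + s k * (inverse (sqrt (?t x)) / 2) * v x)\<^sup>2)"
      by (simp add: norm_vec_def L2_set_def gradient_def sum_nonneg pd del: of_real_add of_real_mult)
    also have "\<dots> = (\<Sum>k\<in>UNIV. ?t x * (d k x)\<^sup>2 + v x * (s k * d k x) + (v x)\<^sup>2 / (4 * ?t x) * (s k)\<^sup>2)"
    proof (rule sum.cong[OF refl])
      fix k
      have sq: "sqrt (?t x) * inverse (sqrt (?t x)) = 1" "(sqrt (?t x))\<^sup>2 = ?t x"
        "(inverse (sqrt (?t x)))\<^sup>2 = 1 / ?t x"
        using t by (auto simp: power_inverse divide_inverse)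
      have "(r * a + b * (r' / 2) * c)\<^sup>2 = r\<^sup>2 * a\<^sup>2 + (r * r') * (c * (b * a)) + c\<^sup>2 * r'\<^sup>2 / 4 * b\<^sup>2"
        for r r' a b c :: real
        by (simp add: power2_eq_square algebra_simps)
      from this[of "sqrt (?t x)" "d k x" "s k" "inverse (sqrt (?t x))" "v x"]
      show "(sqrt (?t x) * d k x + s k * (inverse (sqrt (?t x)) / 2) * v x)\<^sup>2 =
          ?t x * (d k x)\<^sup>2 + v x * (s k * d k x) + (v x)\<^sup>2 / (4 * ?t x) * (s k)\<^sup>2"
        unfolding sq by (simp add: mult.commute)
    qed
    also have "\<dots> = ?t x * (\<Sum>k\<in>UNIV. (d k x)\<^sup>2) + v x * (\<Sum>k\<in>UNIV. s k * d k x)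
        + (v x)\<^sup>2 / (4 * ?t x) * (\<Sum>k\<in>UNIV. (s k)\<^sup>2)"
      by (simp only: sum.distrib sum_distrib_left)
    also have "(\<Sum>k\<in>UNIV. s k * d k x) = frechet_derivative v (at x) ?e"
    proof -
      have "(\<Sum>k\<in>UNIV. s k * d k x) = (\<Sum>k\<in>UNIV. (if k = i then d k x else 0) - (if k = j then d k x else 0))"
        by (intro sum.cong refl) (auto simp: s_def axis_def)
      also have "\<dots> = d i x - d j x" by (simp add: sum_subtractf)
      also have "\<dots> = frechet_derivative v (at x) ?e"
        unfolding d_def using linear_diff[OF has_derivative_linear[OF vd]] by simp
      finally show ?thesis .
    qed
    also have "(\<Sum>k\<in>UNIV. (s k)\<^sup>2) = 2"
    proof -
      have "(\<Sum>k\<in>UNIV. (s k)\<^sup>2) = (\<Sum>k\<in>UNIV. (if k = i then 1 else 0) + (if k = j then 1 else 0))"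
        using ij by (intro sum.cong refl) (auto simp: s_def axis_def)
      then show ?thesis by (simp add: sum.distrib)
    qed
    also have "(v x)\<^sup>2 / (4 * ?t x) * 2 = 1/2 * ((v x)\<^sup>2 / ?t x)"
    proof -
      have "a / (4 * b) * 2 = 1/2 * (a / b)" for a b :: real
        by (cases "b = 0") (auto simp: field_simps)
      then show ?thesis .
    qed
    finally show ?thesis by simp
  next
    case False
    have "u x = 0" if "x \<notin> K" for x using K(3)[OF that] u by simp
    then have "gradient u x = 0"
      unfolding gradient_def vec_eq_iff using partial_deriv_eq_0[OF clK _ False, of u] by simp
    then show ?thesis by (simp add: d_def dv0[OF False] K(3)[OF False])
  qed
  have "(LINT x|lborel. (norm (gradient u x))\<^sup>2) =
     (LINT x|lborel. ?t x * (\<Sum>k\<in>UNIV. (d k x)\<^sup>2) + 1/2 * ((v x)\<^sup>2 / ?t x) + ?c x)"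
    unfolding pt ..
  also have "\<dots> = (LINT x|lborel. ?t x * (\<Sum>k\<in>UNIV. (d k x)\<^sup>2)) + 1/2 * (LINT x|lborel. (v x)\<^sup>2 / ?t x)"
  proof -
    have "(LINT x|lborel. A x + 1/2 * B x + C x) = (LINT x|lborel. A x) + 1/2 * (LINT x|lborel. B x) + (LINT x|lborel. C x)"
      if "integrable lborel A" "integrable lborel B" "integrable lborel C" for A B C :: "real^'n \<Rightarrow> real"
      using that by simp
    from this[OF iA iB iC] show ?thesis unfolding C0 by simp
  qed
  finally show "(LINT x|lborel. (norm (gradient u x))\<^sup>2) =
      (LINT x|lborel. ?t x * (\<Sum>k\<in>UNIV. (d k x)\<^sup>2)) + 1/2 * (LINT x|lborel. (v x)\<^sup>2 / ?t x)" .
qed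

section \<open>Logarithmic cutoffs\<close>

text \<open>A smooth cutoff in the variable \<open>- ln s / R \<in> [0,1]\<close>, that is, supported in \<open>exp (-R) \<le> s \<le> 1\<close> and
  varying slowly on the logarithmic scale.\<close>

definition log_bump :: "real \<Rightarrow> real \<Rightarrow> real" where
  "log_bump R s = (if s > 0 then bump (- ln s / R) * bump (1 + ln s / R) else 0)"

lemma log_bump_nonneg: "0 \<le> log_bump R s"
  by (simp add: log_bump_def bump_nonneg)

lemma log_bump_le_1: "log_bump R s \<le> 1"
  by (simp add: log_bump_def mult_le_one bump_nonneg bump_le_1)

lemma log_bump_eq_0:
  assumes "R > 0" "s \<le> exp (- R) \<or> 1 \<le> s"
  shows "log_bump R s = 0"
proof (cases "s > 0")
  case True
  have "ln s \<le> - R \<or> 0 \<le> ln s" using assms True ln_le_cancel_iff[of s "exp (- R)"] by auto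
  then have "1 + ln s / R \<le> 0 \<or> - ln s / R \<le> 0" using assms(1) by (auto simp: field_simps)
  then show ?thesis by (auto simp: log_bump_def bump_eq_0)
qed (simp add: log_bump_def)

lemma log_bump_ge:
  assumes "R > 0" "exp (- 2 * R / 3) \<le> s" "s \<le> exp (- R / 3)"
  shows "exp (- 6) \<le> log_bump R s"
proof -
  have s: "s > 0" using less_le_trans[OF exp_gt_zero assms(2)] .
  then have "- 2 * R / 3 \<le> ln s" "ln s \<le> - R / 3"
    using assms ln_le_cancel_iff[of "exp (- 2 * R / 3)" s] ln_le_cancel_iff[of s "exp (- R / 3)"] by auto
  then have "1/3 \<le> - ln s / R" "1/3 \<le> 1 + ln s / R" using assms(1) by (auto simp: field_simps)
  moreover have "exp (- 3) \<le> bump a" if "1/3 \<le> a" for a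
    using that by (auto simp: bump_def field_simps)
  ultimately have "exp (- 3) * exp (- 3) \<le> bump (- ln s / R) * bump (1 + ln s / R)"
    by (intro mult_mono) (auto simp: bump_nonneg)
  then show ?thesis using s by (simp add: log_bump_def flip: exp_add)
qed

text \<open>The constant \<open>C\<close> does not depend on \<open>R\<close>; the factor \<open>1/R\<close> is what makes the trial functions optimal
  in the limit.\<close>

lemma log_bump_deriv:
  obtains C where "\<And>R s. R > 0 \<Longrightarrow> \<exists>d. (log_bump R has_real_derivative d) (at s) \<and>
     \<bar>d\<bar> \<le> (if exp (- R) \<le> s \<and> s \<le> 1 then C / (R * s) else 0)"
proof -
  \<comment> \<open>The polynomial that represents the derivative of \<open>bump\<close> in the family \<open>flat\<close>.\<close>
  define q where "q = ([:0,0,1:] * (1 - pderiv 1) :: real poly)"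
  have bd: "(bump has_real_derivative flat q t) (at t)" for t
    using flat_deriv[of 1] by (simp add: bump_flat q_def)
  define b' where "b' t = flat q t * bump (1 - t) - bump t * flat q (1 - t)" for t
  have b: "((\<lambda>t. bump t * bump (1 - t)) has_real_derivative b' t) (at t)" for t
    unfolding b'_def by (auto intro!: derivative_eq_intros DERIV_chain2[OF bd] bd)
  have fc: "continuous_on UNIV (flat q)"
    by (intro continuous_at_imp_continuous_on ballI DERIV_isCont[OF flat_deriv])
  have bc: "continuous_on UNIV bump"
    by (intro continuous_at_imp_continuous_on ballI DERIV_isCont[OF bd])
  have "continuous_on {0..1} b'"
    unfolding b'_def[abs_def]
    by (intro continuous_intros continuous_on_compose2[OF fc] continuous_on_compose2[OF bc]) auto
  then have "bounded (b' ` {0..1})"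
    by (intro compact_imp_bounded compact_continuous_image) auto
  then obtain C where C: "C > 0" "\<And>t. t \<in> {0..1} \<Longrightarrow> \<bar>b' t\<bar> \<le> C"
    by (auto simp: bounded_pos)
  show ?thesis
  proof (rule that[of C])
    fix R s :: real assume R: "R > 0"
    consider "s < exp (- R)" | "1 < s" | "exp (- R) \<le> s" "s \<le> 1" by linarith
    then show "\<exists>d. (log_bump R has_real_derivative d) (at s) \<and>
       \<bar>d\<bar> \<le> (if exp (- R) \<le> s \<and> s \<le> 1 then C / (R * s) else 0)"
    proof cases
      case 1
      have "(log_bump R has_real_derivative 0) (at s)"
        by (rule has_field_derivative_transform_within_open[OF DERIV_const[of 0], of "{..<exp (- R)}"])
          (use 1 R log_bump_eq_0 in auto)
      then show ?thesis using 1 by force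
    next
      case 2
      have "(log_bump R has_real_derivative 0) (at s)"
        by (rule has_field_derivative_transform_within_open[OF DERIV_const[of 0], of "{1<..}"])
          (use 2 R log_bump_eq_0 in auto)
      then show ?thesis using 2 by force
    next
      case 3
      then have s: "s > 0" using less_le_trans[OF exp_gt_zero] by blast
      have ln: "((\<lambda>s. - ln s / R) has_real_derivative - (1 / s) / R) (at s)"
        using s R by (auto intro!: derivative_eq_intros)
      have "((\<lambda>s. bump (- ln s / R) * bump (1 - (- ln s / R))) has_real_derivative b' (- ln s / R) * (- (1 / s) / R)) (at s)"
        using DERIV_chain2[OF b ln] .
      then have "(log_bump R has_real_derivative b' (- ln s / R) * (- (1 / s) / R)) (at s)"
        by (rule has_field_derivative_transform_within_open[of _ _ _ "{0<..}"])
          (use s in \<open>auto simp: log_bump_def\<close>)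
      moreover have "\<bar>b' (- ln s / R) * (- (1 / s) / R)\<bar> \<le> C / (R * s)"
      proof -
        have "- R \<le> ln s" "ln s \<le> 0" using 3 s by (simp_all add: ln_ge_iff)
        then have "- ln s / R \<in> {0..1}" using R by (auto simp: field_simps)
        then have "\<bar>b' (- ln s / R)\<bar> / (R * s) \<le> C / (R * s)"
          using C R s by (intro divide_right_mono) auto
        then show ?thesis using R s by (simp add: abs_mult mult.commute)
      qed
      ultimately show ?thesis using 3 by auto
    qed
  qed
qed

text \<open>The product is smooth everywhere although \<open>h\<close> is smooth only where \<open>t > 0\<close>, since the cutoff
  vanishes for \<open>t < exp (-R)\<close>.\<close>

lemma Ck_on_log_bump:
  fixes t :: "'a::real_normed_vector \<Rightarrow> real"
  assumes t: "bounded_linear t" and R: "R > 0" and h: "Ck_on k {x. 0 < t x} h"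
  shows "Ck_on k UNIV (\<lambda>x. log_bump R (t x) * h x)"
proof -
  have tc: "continuous_on UNIV t" using t linear_continuous_on by blast
  have A: "open {x. 0 < t x}" and B: "open {x. t x < exp (- R)}"
    by (intro open_Collect_less tc continuous_intros)+
  have ln: "Ck_on k {x. 0 < t x} (\<lambda>x. ln (t x))"
    by (rule Ck_on_ln[OF A _ Ck_on_bounded_linear[OF t A]]) auto
  have 1: "Ck_on k {x. 0 < t x} (\<lambda>x. (- 1 / R) * ln (t x))"
    and 2: "Ck_on k {x. 0 < t x} (\<lambda>x. 1 + (1 / R) * ln (t x))"
    using Ck_on_add[OF A] Ck_on_mult[OF A] Ck_on_const[OF A] ln by blast+
  have "Ck_on k {x. 0 < t x} (\<lambda>x. bump ((- 1 / R) * ln (t x)) * bump (1 + (1 / R) * ln (t x)) * h x)"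
    by (rule Ck_on_mult[OF A Ck_on_mult[OF A Ck_on_bump[OF A 1] Ck_on_bump[OF A 2]] h])
  then have "Ck_on k {x. 0 < t x} (\<lambda>x. log_bump R (t x) * h x)"
    by (rule Ck_on_cong[OF A, rotated]) (simp add: log_bump_def)
  moreover have "Ck_on k {x. t x < exp (- R)} (\<lambda>x. log_bump R (t x) * h x)"
    by (rule Ck_on_cong[OF B _ Ck_on_const[OF B, of k 0]]) (use R log_bump_eq_0 in auto)
  ultimately have "Ck_on k ({x. 0 < t x} \<union> {x. t x < exp (- R)}) (\<lambda>x. log_bump R (t x) * h x)"
    by (rule Ck_on_Un[OF A B])
  moreover have "{x. 0 < t x} \<union> {x. t x < exp (- R)} = UNIV"
    using less_le_trans[OF exp_gt_zero] by (auto simp: not_less)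
  ultimately show ?thesis by simp
qed


section \<open>Trial functions concentrated near one pair collision\<close>

text \<open>A cutoff that keeps every particle \<open>k\<close> other than \<open>i\<close> within distance \<open>1\<close> of \<open>p k\<close>.  It does not
  depend on \<open>x\<^sub>i\<close>.\<close>

definition transversal :: "('n \<Rightarrow> real) \<Rightarrow> 'n \<Rightarrow> real^'n \<Rightarrow> real" where
  "transversal p i x = (\<Prod>k\<in>UNIV - {i}. bump (1 + (x $ k - p k)) * bump (1 - (x $ k - p k)))"

text \<open>The configurations with \<open>a \<le> x\<^sub>i - x\<^sub>j \<le> b\<close> that are allowed by the transversal cutoff.\<close>

definition slab :: "('n \<Rightarrow> real) \<Rightarrow> 'n \<Rightarrow> 'n \<Rightarrow> real \<Rightarrow> real \<Rightarrow> (real^'n) set" where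
  "slab p i j a b = {x. a \<le> x $ i - x $ j \<and> x $ i - x $ j \<le> b \<and> (\<forall>k. k \<noteq> i \<longrightarrow> \<bar>x $ k - p k\<bar> \<le> 1)}"

lemma Ck_on_transversal: "Ck_on m UNIV (transversal p i)"
proof -
  have lin: "Ck_on m UNIV (\<lambda>x::real^'a. x $ k)" for k
    by (intro Ck_on_bounded_linear bounded_linear_vec_nth open_UNIV)
  have "Ck_on m UNIV (\<lambda>x::real^'a. (1 - p k) + x $ k)" "Ck_on m UNIV (\<lambda>x::real^'a. (1 + p k) + (- 1) * x $ k)" for k
    by (intro Ck_on_add Ck_on_mult Ck_on_const lin open_UNIV)+
  then have lin': "Ck_on m UNIV (\<lambda>x::real^'a. 1 + (x $ k - p k))" "Ck_on m UNIV (\<lambda>x::real^'a. 1 - (x $ k - p k))" for k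
    by (simp_all add: algebra_simps)
  have "Ck_on m UNIV (\<lambda>x::real^'a. bump (1 + (x $ k - p k)) * bump (1 - (x $ k - p k)))" for k
    by (rule Ck_on_mult[OF open_UNIV Ck_on_bump[OF open_UNIV lin'(1)] Ck_on_bump[OF open_UNIV lin'(2)]])
  then show ?thesis
    unfolding transversal_def[abs_def] by (intro Ck_on_prod[OF open_UNIV]) auto
qed

lemma transversal_eq_0:
  assumes "k \<noteq> i" "1 < \<bar>x $ k - p k\<bar>"
  shows "transversal p i x = 0"
proof -
  have "bump (1 + (x $ k - p k)) * bump (1 - (x $ k - p k)) = 0"
  proof -
    have "1 + (x $ k - p k) \<le> 0 \<or> 1 - (x $ k - p k) \<le> 0" using assms(2) by linarith
    then show ?thesis by (metis bump_eq_0 mult_zero_left mult_zero_right)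
  qed
  then show ?thesis unfolding transversal_def using assms(1) by (intro prod_zero) auto
qed

lemma transversal_translate: "transversal p i (x + s *\<^sub>R axis i 1) = transversal p i x"
  unfolding transversal_def by (intro prod.cong refl) (auto simp: axis_def)

lemma compact_slab:
  assumes "i \<noteq> j"
  shows "compact (slab p i j a b)"
proof -
  have "closed (slab p i j a b)"
    unfolding slab_def
    by (intro closed_Collect_conj closed_Collect_all closed_Collect_imp open_Collect_const
        closed_Collect_le continuous_intros)
  moreover have "bounded (slab p i j a b)"
  proof (rule bounded_subset[OF bounded_cbox])
    define c where "c k = (if k = i then \<bar>a\<bar> + \<bar>b\<bar> + \<bar>p j\<bar> + 1 else \<bar>p k\<bar> + 1)" for k
    show "slab p i j a b \<subseteq> cbox (\<chi> k. - c k) (\<chi> k. c k)"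
    proof
      fix x assume x: "x \<in> slab p i j a b"
      have k: "\<bar>x $ k - p k\<bar> \<le> 1" if "k \<noteq> i" for k using x that by (auto simp: slab_def)
      have "\<bar>x $ k\<bar> \<le> c k" for k
      proof (cases "k = i")
        case True
        have "a \<le> x $ i - x $ j" "x $ i - x $ j \<le> b" using x by (auto simp: slab_def)
        then show ?thesis using k[of j] assms True by (simp add: c_def)
      next
        case False
        then show ?thesis using k[OF False] by (simp add: c_def)
      qed
      then show "x \<in> cbox (\<chi> k. - c k) (\<chi> k. c k)"
        by (auto simp: mem_box_cart abs_le_iff) (metis minus_le_iff)
    qed
  qed
  ultimately show ?thesis by (simp add: compact_eq_bounded_closed)
qed

text \<open>The centres \<open>p k\<close> are so far apart that only the particles \<open>i\<close> and \<open>j\<close> come close to each other.\<close>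

lemma slab_no_collision:
  assumes sep: "\<And>k l. k \<noteq> l \<Longrightarrow> 10 \<le> \<bar>p k - p l\<bar>" and ij: "i \<noteq> j" and "0 < a" "b \<le> 1"
  shows "slab p i j a b \<subseteq> UNIV - collision_set"
proof
  fix x assume x: "x \<in> slab p i j a b"
  have k: "\<bar>x $ k - p k\<bar> \<le> 1" if "k \<noteq> i" for k using x that by (auto simp: slab_def)
  have t: "0 < x $ i - x $ j" "x $ i - x $ j \<le> 1" using x assms by (auto simp: slab_def)
  have 1: "x $ i \<noteq> x $ l" if "l \<noteq> i" for l
  proof (cases "l = j")
    case False
    show ?thesis using t k[OF that] k[of j] ij sep[OF False] by auto
  qed (use t in auto)
  have 2: "x $ k \<noteq> x $ l" if "k \<noteq> l" "k \<noteq> i" "l \<noteq> i" for k l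
    using k[OF that(2)] k[OF that(3)] sep[OF that(1)] by auto
  have "x $ k \<noteq> x $ l" if "k \<noteq> l" for k l
    using 1 2 that by metis
  then show "x \<in> UNIV - collision_set" by (auto simp: collision_set_def)
qed

text \<open>The factor \<open>v\<close> of the trial function \<open>sqrt t v\<close>, where \<open>t = x\<^sub>i - x\<^sub>j\<close>.\<close>

definition trial :: "('n \<Rightarrow> real) \<Rightarrow> 'n \<Rightarrow> 'n \<Rightarrow> real \<Rightarrow> real^'n \<Rightarrow> real" where
  "trial p i j R x = log_bump R (x $ i - x $ j) * transversal p i x"

lemma trial_eq_0:
  assumes "R > 0" "x \<notin> slab p i j (exp (- R)) 1"
  shows "trial p i j R x = 0"
  using assms log_bump_eq_0[of R "x $ i - x $ j"] transversal_eq_0[of _ i x p]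
  unfolding trial_def slab_def by fastforce

lemma Ck_on_trial: "R > 0 \<Longrightarrow> Ck_on m UNIV (trial p i j R)"
  unfolding trial_def[abs_def]
  by (rule Ck_on_log_bump[OF bounded_linear_component_diff _ Ck_on_subset[OF Ck_on_transversal subset_UNIV]])

lemma slab_pos: "0 < a \<Longrightarrow> x \<in> slab p i j a b \<Longrightarrow> 0 < x $ i - x $ j"
  by (auto simp: slab_def)

lemma trial_test_function:
  assumes "\<And>k l. k \<noteq> l \<Longrightarrow> 10 \<le> \<bar>p k - p l\<bar>" "i \<noteq> j" "R > 0"
  shows "(\<lambda>x. complex_of_real (sqrt (x $ i - x $ j) * trial p i j R x)) \<in> test_functions (UNIV - collision_set)"
proof (rule test_functionsI)
  let ?A = "{x::real^'a. 0 < x $ i - x $ j}"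
  have A: "open ?A" by (intro open_Collect_less continuous_intros)
  have "Ck_on m ?A (\<lambda>x. (x $ i - x $ j) powr (1/2) * transversal p i x)" for m
    by (intro Ck_on_mult[OF A] Ck_on_powr[OF A] Ck_on_bounded_linear[OF bounded_linear_component_diff A]
        Ck_on_subset[OF Ck_on_transversal]) auto
  then have "Ck_on m ?A (\<lambda>x. sqrt (x $ i - x $ j) * transversal p i x)" for m
    by (rule Ck_on_cong[OF A, rotated]) (simp add: powr_half_sqrt)
  then have "Ck_on m UNIV (\<lambda>x. log_bump R (x $ i - x $ j) * (sqrt (x $ i - x $ j) * transversal p i x))" for m
    by (rule Ck_on_log_bump[OF bounded_linear_component_diff assms(3)])
  then have "Ck_on m UNIV (\<lambda>x. sqrt (x $ i - x $ j) * trial p i j R x)" for m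
    by (simp add: trial_def mult.left_commute)
  then have "Ck_on m UNIV (\<lambda>x. complex_of_real (sqrt (x $ i - x $ j) * trial p i j R x))" for m
    by (rule Ck_on_bounded_linear_compose[OF bounded_linear_of_real open_UNIV])
  then show "Ck m (\<lambda>x. complex_of_real (sqrt (x $ i - x $ j) * trial p i j R x))" for m
    using Ck_on_UNIV by blast
  show "compact (slab p i j (exp (- R)) 1)" using compact_slab assms by blast
  show "slab p i j (exp (- R)) 1 \<subseteq> UNIV - collision_set" by (rule slab_no_collision[OF assms(1,2)]) (use assms(3) in auto)
  show "complex_of_real (sqrt (x $ i - x $ j) * trial p i j R x) = 0" if "x \<notin> slab p i j (exp (- R)) 1" for x
    using trial_eq_0[OF assms(3) that] by simp
qed

lemma continuous_transversal: "continuous_on S (transversal p i)"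
  by (rule continuous_on_subset[OF Ck_on_continuous[OF Ck_on_transversal] subset_UNIV])

lemma continuous_transversal_derivative:
  "continuous_on S (\<lambda>x. frechet_derivative (transversal p i) (at x) w)"
  using Ck_on_transversal[of "Suc 0" p i] by (auto intro: continuous_on_subset[OF _ subset_UNIV])

lemma transversal_derivative:
  "(transversal p i has_derivative frechet_derivative (transversal p i) (at x)) (at x)"
  using Ck_on_SucD(1)[OF Ck_on_transversal] by blast

lemma transversal_measurable [measurable]: "transversal p i \<in> borel_measurable borel"
  by (intro borel_measurable_continuous_onI continuous_transversal)

lemma integrable_slab:
  fixes f :: "real^'n \<Rightarrow> real"
  assumes "i \<noteq> j" "continuous_on UNIV f" "\<And>x k. k \<noteq> i \<Longrightarrow> 1 < \<bar>x $ k - p k\<bar> \<Longrightarrow> f x = 0"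
  shows "integrable lborel (\<lambda>x. indicator {0..1} (x $ i - x $ j) * f x)"
proof -
  have "(\<lambda>x. indicator {0..1} (x $ i - x $ j) * f x) = (\<lambda>x. indicator (slab p i j 0 1) x *\<^sub>R f x)"
  proof
    show "indicator {0..1} (x $ i - x $ j) * f x = indicator (slab p i j 0 1) x *\<^sub>R f x" for x
      using assms(3)[of _ x] by (fastforce simp: indicator_def slab_def not_le)
  qed
  then show ?thesis
    using borel_integrable_compact[OF compact_slab[OF assms(1), of p 0 1]
        continuous_on_subset[OF assms(2) subset_UNIV]] by (simp only:)
qed

text \<open>The factor in \<open>nn_integral_component_diff\<close> for the squared transversal cutoff.\<close>

lemma transversal_mass:
  fixes p :: "'n::finite \<Rightarrow> real"
  assumes ij: "i \<noteq> j"
  defines "M \<equiv> LINT x|lborel. indicator {0..1} (x $ i - x $ j) * (transversal p i x)\<^sup>2"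
  shows "M > 0"
    and "(\<integral>\<^sup>+x. indicator {0..1} (x $ i - x $ j) * ennreal ((transversal p i x)\<^sup>2) \<partial>lborel) = ennreal M"
proof -
  let ?f = "\<lambda>x. indicator {0..1} (x $ i - x $ j) * (transversal p i x)\<^sup>2"
  have int: "integrable lborel ?f"
    by (rule integrable_slab[OF ij, of _ p])
      (auto intro!: continuous_intros continuous_transversal transversal_eq_0)
  have "(\<integral>\<^sup>+x. ennreal (?f x) \<partial>lborel) = ennreal M"
    unfolding M_def by (rule nn_integral_eq_integral[OF int]) auto
  moreover have "ennreal (?f x) = indicator {0..1} (x $ i - x $ j) * ennreal ((transversal p i x)\<^sup>2)" for x
    by (auto simp: indicator_def)
  ultimately show "(\<integral>\<^sup>+x. indicator {0..1} (x $ i - x $ j) * ennreal ((transversal p i x)\<^sup>2) \<partial>lborel) = ennreal M"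
    by simp
  have "M \<ge> 0" unfolding M_def by (intro integral_nonneg_AE) auto
  moreover have "M \<noteq> 0"
  proof
    assume "M = 0"
    then have ae: "AE x in lborel. ?f x = 0"
      unfolding M_def using integral_nonneg_eq_0_iff_AE[OF int] by auto
    let ?S = "{x::real^'n. 0 < x $ i - x $ j} \<inter> {x. x $ i - x $ j < 1} \<inter> {x. 0 < transversal p i x}"
    have op: "open ?S"
      by (intro open_Int open_Collect_less continuous_intros continuous_transversal)
    moreover have "?S \<noteq> {}"
    proof -
      define x :: "real^'n" where "x = (\<chi> k. if k = i then p j + 1/2 else p k)"
      have "x \<in> ?S"
        using ij by (auto simp: x_def transversal_def intro!: zero_less_power mult_pos_pos bump_pos)
      then show ?thesis by blast
    qed
    ultimately have "\<not> negligible ?S" using open_not_negligible[OF op] by blast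
    moreover have "negligible ?S"
    proof -
      have "AE x in lebesgue. ?f x = 0" using ae by (rule AE_completion)
      then have "AE x in lebesgue. x \<notin> ?S" by eventually_elim (auto simp: indicator_def)
      then show ?thesis
        unfolding negligible_iff_null_sets
        using AE_iff_null_sets[of ?S lebesgue] borel_open[OF op] by simp
    qed
    ultimately show False by blast
  qed
  ultimately show "M > 0" by simp
qed

text \<open>The mass \<open>\<integral> v\<^sup>2 / t\<close> grows at least linearly in \<open>R\<close>: on \<open>exp (-2R/3) \<le> t \<le> exp (-R/3)\<close> the logarithmic
  cutoff is at least \<open>exp (-6)\<close>, and the integral of \<open>1/t\<close> over this interval is \<open>R/3\<close>.\<close>

lemma trial_mass_ge:
  fixes p :: "'n::finite \<Rightarrow> real"
  assumes ij: "i \<noteq> j" and R: "R > 0"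
    and int: "integrable lborel (\<lambda>x. (trial p i j R x)\<^sup>2 / (x $ i - x $ j))"
  defines "M \<equiv> LINT x|lborel. indicator {0..1} (x $ i - x $ j) * (transversal p i x)\<^sup>2"
  shows "exp (- 12) * R / 3 * M \<le> (LINT x|lborel. (trial p i j R x)\<^sup>2 / (x $ i - x $ j))"
proof -
  let ?a = "exp (- 2 * R / 3)" and ?b = "exp (- R / 3)"
  let ?f = "\<lambda>s::real. ennreal (exp (- 12)) * ennreal (indicator {?a..?b} s / s)"
  have M: "M > 0" using transversal_mass(1)[OF ij, of p] by (simp add: M_def)
  have nonneg: "0 \<le> (trial p i j R x)\<^sup>2 / (x $ i - x $ j)" for x
    using trial_eq_0[OF R, of x p i j] slab_pos[of "exp (- R)" x p i j 1]
    by (cases "x \<in> slab p i j (exp (- R)) 1") auto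
  have "ennreal (exp (- 12) * R / 3 * M) = ennreal (exp (- 12)) * ennreal (R / 3) * ennreal M"
    using R M by (simp add: ennreal_mult[symmetric])
  also have "ennreal (exp (- 12)) * ennreal (R / 3) = (\<integral>\<^sup>+s. ?f s \<partial>lborel)"
    using nn_integral_reciprocal[of ?a ?b] R by (simp add: nn_integral_cmult)
  also have "\<dots> * ennreal M = (\<integral>\<^sup>+x. ?f (x $ i - x $ j) * ennreal ((transversal p i x)\<^sup>2) \<partial>lborel)"
    unfolding M_def transversal_mass(2)[OF ij, symmetric]
    by (rule nn_integral_component_diff[OF _ _ _ ij, symmetric]) (auto simp: transversal_translate)
  also have "\<dots> \<le> (\<integral>\<^sup>+x. ennreal ((trial p i j R x)\<^sup>2 / (x $ i - x $ j)) \<partial>lborel)"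
  proof (rule nn_integral_mono)
    fix x :: "real^'n"
    let ?t = "x $ i - x $ j"
    show "?f ?t * ennreal ((transversal p i x)\<^sup>2) \<le> ennreal ((trial p i j R x)\<^sup>2 / ?t)"
    proof (cases "?t \<in> {?a..?b}")
      case True
      then have t: "?t > 0" using less_le_trans[OF exp_gt_zero, of "- 2 * R / 3" ?t] by auto
      have "exp (- 6) \<le> log_bump R ?t" using log_bump_ge[OF R] True by auto
      then have "(exp (- 6))\<^sup>2 \<le> (log_bump R ?t)\<^sup>2" by (intro power_mono) auto
      then have "exp (- 12) \<le> (log_bump R ?t)\<^sup>2" by (simp add: power2_eq_square flip: exp_add)
      then have "exp (- 12) * ((transversal p i x)\<^sup>2 / ?t) \<le> (log_bump R ?t)\<^sup>2 * ((transversal p i x)\<^sup>2 / ?t)"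
        using t by (intro mult_right_mono) auto
      then have "exp (- 12) * (1 / ?t) * (transversal p i x)\<^sup>2 \<le> (trial p i j R x)\<^sup>2 / ?t"
        by (simp add: trial_def power_mult_distrib)
      moreover have "?f ?t * ennreal ((transversal p i x)\<^sup>2) = ennreal (exp (- 12) * (1 / ?t) * (transversal p i x)\<^sup>2)"
      proof -
        have "?f ?t = ennreal (exp (- 12) * (1 / ?t))"
          using True t by (simp add: ennreal_mult[symmetric])
        then show ?thesis using t by (subst ennreal_mult) auto
      qed
      ultimately show ?thesis by (simp only: ennreal_leI)
    qed simp
  qed
  also have "\<dots> = ennreal (LINT x|lborel. (trial p i j R x)\<^sup>2 / (x $ i - x $ j))"
    by (rule nn_integral_eq_integral[OF int]) (use nonneg in auto)
  finally show ?thesis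
    by (subst (asm) ennreal_le_iff) (use nonneg in \<open>auto intro!: integral_nonneg_AE\<close>)
qed

lemma trial_gradient_pointwise:
  fixes p :: "'n::finite \<Rightarrow> real"
  assumes ij: "i \<noteq> j" and R: "R > 0"
    and C: "\<And>s. \<exists>d. (log_bump R has_real_derivative d) (at s) \<and>
     \<bar>d\<bar> \<le> (if exp (- R) \<le> s \<and> s \<le> 1 then C / (R * s) else 0)"
  shows "(x $ i - x $ j) * (\<Sum>k\<in>UNIV. (frechet_derivative (trial p i j R) (at x) (axis k 1))\<^sup>2)
    \<le> 4 * C\<^sup>2 / R\<^sup>2 * (indicator {exp (- R)..1} (x $ i - x $ j) / (x $ i - x $ j)) * (transversal p i x)\<^sup>2
     + 2 * (indicator {0..1} (x $ i - x $ j) * (\<Sum>k\<in>UNIV. (frechet_derivative (transversal p i) (at x) (axis k 1))\<^sup>2))"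
proof (cases "x \<in> slab p i j (exp (- R)) 1")
  case False
  have r: "0 \<le> indicator {exp (- R)..1} s / s" for s :: real
    using less_le_trans[OF exp_gt_zero, of "- R" s] by (auto simp: indicator_def)
  have "frechet_derivative (trial p i j R) (at x) = (\<lambda>_. 0)"
    by (rule frechet_derivative_eq_0[OF compact_imp_closed[OF compact_slab[OF ij]] trial_eq_0[OF R] False])
  then have "(x $ i - x $ j) * (\<Sum>k\<in>UNIV. (frechet_derivative (trial p i j R) (at x) (axis k 1))\<^sup>2) = 0"
    by simp
  moreover have "0 \<le> 4 * C\<^sup>2 / R\<^sup>2 * (indicator {exp (- R)..1} (x $ i - x $ j) / (x $ i - x $ j)) * (transversal p i x)\<^sup>2"
    by (intro mult_nonneg_nonneg[OF mult_nonneg_nonneg[OF _ r]]) auto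
  moreover have "0 \<le> indicator {0..1} (x $ i - x $ j) * (\<Sum>k\<in>UNIV. (frechet_derivative (transversal p i) (at x) (axis k 1))\<^sup>2)"
    by (auto intro!: mult_nonneg_nonneg sum_nonneg)
  ultimately show ?thesis by linarith
next
  case True
  let ?t = "x $ i - x $ j" and ?h = "transversal p i x"
  define D where "D k = frechet_derivative (transversal p i) (at x) (axis k 1)" for k
  define s where "s k = (axis k 1 :: real^'n) $ i - axis k 1 $ j" for k
  have t: "exp (- R) \<le> ?t" "?t \<le> 1" "0 < ?t"
    using True slab_pos[OF exp_gt_zero True] by (auto simp: slab_def)
  obtain L where L: "(log_bump R has_real_derivative L) (at ?t)" "\<bar>L\<bar> \<le> C / (R * ?t)"
    using C[of ?t] t by auto
  have "((\<lambda>x. log_bump R (x $ i - x $ j)) has_derivative (\<lambda>w. (w $ i - w $ j) * L)) (at x)"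
    using DERIV_compose_FDERIV[OF L(1) bounded_linear_imp_has_derivative[OF bounded_linear_component_diff]] by simp
  from has_derivative_mult[OF this transversal_derivative]
  have "(trial p i j R has_derivative (\<lambda>w. log_bump R ?t * frechet_derivative (transversal p i) (at x) w
      + (w $ i - w $ j) * L * ?h)) (at x)"
    by (simp add: trial_def[abs_def])
  note fd = frechet_derivative_at[OF this, symmetric]
  have d: "frechet_derivative (trial p i j R) (at x) (axis k 1) = log_bump R ?t * D k + s k * L * ?h" for k
    unfolding fd D_def s_def ..
  have "(log_bump R ?t * D k + s k * L * ?h)\<^sup>2 \<le> 2 * (D k)\<^sup>2 + 2 * (L\<^sup>2 * ?h\<^sup>2) * (s k)\<^sup>2" for k
  proof -
    have "(log_bump R ?t * D k + s k * L * ?h)\<^sup>2 \<le> 2 * (log_bump R ?t * D k)\<^sup>2 + 2 * (s k * L * ?h)\<^sup>2"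
      using norm_add_square_le[of 1 "log_bump R ?t * D k" "s k * L * ?h"] by simp
    also have "(log_bump R ?t * D k)\<^sup>2 \<le> (D k)\<^sup>2"
      using log_bump_nonneg[of R ?t] log_bump_le_1[of R ?t]
      by (simp add: power_mult_distrib mult_left_le_one_le power_le_one)
    finally show ?thesis by (simp add: power_mult_distrib mult.commute mult.left_commute)
  qed
  then have "(\<Sum>k\<in>UNIV. (frechet_derivative (trial p i j R) (at x) (axis k 1))\<^sup>2)
      \<le> (\<Sum>k\<in>UNIV. 2 * (D k)\<^sup>2 + 2 * (L\<^sup>2 * ?h\<^sup>2) * (s k)\<^sup>2)"
    unfolding d by (intro sum_mono)
  also have "\<dots> = 2 * (\<Sum>k\<in>UNIV. (D k)\<^sup>2) + 2 * (L\<^sup>2 * ?h\<^sup>2) * (\<Sum>k\<in>UNIV. (s k)\<^sup>2)"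
    by (simp only: sum.distrib sum_distrib_left)
  also have "(\<Sum>k\<in>UNIV. (s k)\<^sup>2) = 2"
  proof -
    have "(\<Sum>k\<in>UNIV. (s k)\<^sup>2) = (\<Sum>k\<in>UNIV. (if k = i then 1 else 0) + (if k = j then 1 else 0))"
      using ij by (intro sum.cong refl) (auto simp: s_def axis_def)
    then show ?thesis by (simp add: sum.distrib)
  qed
  finally have "?t * (\<Sum>k\<in>UNIV. (frechet_derivative (trial p i j R) (at x) (axis k 1))\<^sup>2)
      \<le> ?t * (2 * (\<Sum>k\<in>UNIV. (D k)\<^sup>2) + 2 * (L\<^sup>2 * ?h\<^sup>2) * 2)"
    using t by (intro mult_left_mono) auto
  also have "\<dots> = 2 * (?t * (\<Sum>k\<in>UNIV. (D k)\<^sup>2)) + 4 * (?t * L\<^sup>2) * ?h\<^sup>2"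
    by (simp add: algebra_simps)
  also have "\<dots> \<le> 2 * (1 * (\<Sum>k\<in>UNIV. (D k)\<^sup>2)) + 4 * (C\<^sup>2 / (R\<^sup>2 * ?t)) * ?h\<^sup>2"
  proof -
    have "L\<^sup>2 \<le> (C / (R * ?t))\<^sup>2"
      using L(2) power_mono[OF L(2), of 2] by simp
    then have "?t * L\<^sup>2 \<le> ?t * (C / (R * ?t))\<^sup>2" using t by (intro mult_left_mono) auto
    also have "\<dots> = C\<^sup>2 / (R\<^sup>2 * ?t)" using t by (simp add: power2_eq_square)
    finally have "?t * L\<^sup>2 \<le> C\<^sup>2 / (R\<^sup>2 * ?t)" .
    then show ?thesis
      using t by (intro add_mono mult_left_mono mult_right_mono) (auto intro: sum_nonneg)
  qed
  finally show ?thesis using t by (simp add: D_def)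
qed

text \<open>In contrast to the mass, \<open>\<integral> t \<bar>\<nabla>v\<bar>\<^sup>2\<close> stays bounded as \<open>R\<close> grows.\<close>

lemma trial_gradient_le:
  fixes p :: "'n::finite \<Rightarrow> real"
  assumes ij: "i \<noteq> j" and R: "R > 0"
    and C: "\<And>s. \<exists>d. (log_bump R has_real_derivative d) (at s) \<and>
     \<bar>d\<bar> \<le> (if exp (- R) \<le> s \<and> s \<le> 1 then C / (R * s) else 0)"
    and int: "integrable lborel (\<lambda>x. (x $ i - x $ j) * (\<Sum>k\<in>UNIV. (frechet_derivative (trial p i j R) (at x) (axis k 1))\<^sup>2))"
  defines "M \<equiv> LINT x|lborel. indicator {0..1} (x $ i - x $ j) * (transversal p i x)\<^sup>2"
    and "N \<equiv> LINT x|lborel. indicator {0..1} (x $ i - x $ j) *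
      (\<Sum>k\<in>UNIV. (frechet_derivative (transversal p i) (at x) (axis k 1))\<^sup>2)"
  shows "(LINT x|lborel. (x $ i - x $ j) * (\<Sum>k\<in>UNIV. (frechet_derivative (trial p i j R) (at x) (axis k 1))\<^sup>2))
    \<le> 4 * C\<^sup>2 / R * M + 2 * N"
proof -
  let ?G = "\<lambda>x. (x $ i - x $ j) * (\<Sum>k\<in>UNIV. (frechet_derivative (trial p i j R) (at x) (axis k 1))\<^sup>2)"
  let ?H = "\<lambda>x. indicator {0..1} (x $ i - x $ j) * (\<Sum>k\<in>UNIV. (frechet_derivative (transversal p i) (at x) (axis k 1))\<^sup>2)"
  let ?f = "\<lambda>s::real. ennreal (4 * C\<^sup>2 / R\<^sup>2) * ennreal (indicator {exp (- R)..1} s / s)"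
  have M: "M > 0" using transversal_mass(1)[OF ij, of p] by (simp add: M_def)
  have pos: "0 \<le> indicator {exp (- R)..1} s / s" for s :: real
    using less_le_trans[OF exp_gt_zero, of "- R" s] by (auto simp: indicator_def)
  have Hpos: "0 \<le> ?H x" for x :: "real^'n" by (auto intro!: mult_nonneg_nonneg sum_nonneg)
  have Hint: "integrable lborel ?H"
  proof (rule integrable_slab[OF ij, of _ p])
    show "continuous_on UNIV (\<lambda>x. \<Sum>k\<in>UNIV. (frechet_derivative (transversal p i) (at x) (axis k 1))\<^sup>2)"
      by (intro continuous_intros continuous_transversal_derivative)
    fix x :: "real^'n" and k assume k: "k \<noteq> i" "1 < \<bar>x $ k - p k\<bar>"
    have cl: "closed {x::real^'n. \<bar>x $ k - p k\<bar> \<le> 1}" by (intro closed_Collect_le continuous_intros)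
    have "frechet_derivative (transversal p i) (at x) = (\<lambda>_. 0)"
      by (rule frechet_derivative_eq_0[OF cl]) (use k transversal_eq_0[of k i _ p] in \<open>auto simp: not_le\<close>)
    then show "(\<Sum>k\<in>UNIV. (frechet_derivative (transversal p i) (at x) (axis k 1))\<^sup>2) = 0" by simp
  qed
  have N: "N \<ge> 0" unfolding N_def using Hpos by (intro integral_nonneg_AE) auto
  have Gpos: "0 \<le> ?G x" for x
  proof (cases "x \<in> slab p i j (exp (- R)) 1")
    case True
    then show ?thesis using slab_pos[OF exp_gt_zero True] by (auto intro!: mult_nonneg_nonneg sum_nonneg)
  next
    case False
    have "frechet_derivative (trial p i j R) (at x) = (\<lambda>_. 0)"
      by (rule frechet_derivative_eq_0[OF compact_imp_closed[OF compact_slab[OF ij]] trial_eq_0[OF R] False])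
    then show ?thesis by simp
  qed
  have "ennreal (LINT x|lborel. ?G x) = (\<integral>\<^sup>+x. ennreal (?G x) \<partial>lborel)"
    by (rule nn_integral_eq_integral[OF int, symmetric]) (use Gpos in auto)
  also have "\<dots> \<le> (\<integral>\<^sup>+x. ?f (x $ i - x $ j) * ennreal ((transversal p i x)\<^sup>2) + ennreal (2 * ?H x) \<partial>lborel)"
  proof (rule nn_integral_mono)
    fix x :: "real^'n"
    have "ennreal (?G x) \<le> ennreal (4 * C\<^sup>2 / R\<^sup>2 * (indicator {exp (- R)..1} (x $ i - x $ j) / (x $ i - x $ j))
        * (transversal p i x)\<^sup>2 + 2 * ?H x)"
      by (intro ennreal_leI trial_gradient_pointwise[OF ij R C])
    also have "\<dots> = ?f (x $ i - x $ j) * ennreal ((transversal p i x)\<^sup>2) + ennreal (2 * ?H x)"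
    proof -
      have gen: "ennreal (a * r * h + b) = ennreal a * ennreal r * ennreal h + ennreal b"
        if "0 \<le> a" "0 \<le> r" "0 \<le> h" "0 \<le> b" for a r h b :: real
        using that by (simp add: ennreal_mult)
      show ?thesis
        by (rule gen) (use pos[of "x $ i - x $ j"] Hpos[of x] in \<open>simp_all only: zero_le_power2\<close>, simp_all)
    qed
    finally show "ennreal (?G x) \<le> ?f (x $ i - x $ j) * ennreal ((transversal p i x)\<^sup>2) + ennreal (2 * ?H x)" .
  qed
  also have "\<dots> = (\<integral>\<^sup>+x. ?f (x $ i - x $ j) * ennreal ((transversal p i x)\<^sup>2) \<partial>lborel) + (\<integral>\<^sup>+x. ennreal (2 * ?H x) \<partial>lborel)"
    using Hint by (intro nn_integral_add) auto
  also have "(\<integral>\<^sup>+x. ennreal (2 * ?H x) \<partial>lborel) = ennreal (2 * N)"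
  proof -
    have "(\<integral>\<^sup>+x. ennreal (2 * ?H x) \<partial>lborel) = ennreal (LINT x|lborel. 2 * ?H x)"
      using Hint Hpos by (intro nn_integral_eq_integral AE_I2) auto
    then show ?thesis by (simp add: N_def)
  qed
  also have "(\<integral>\<^sup>+x. ?f (x $ i - x $ j) * ennreal ((transversal p i x)\<^sup>2) \<partial>lborel) = (\<integral>\<^sup>+s. ?f s \<partial>lborel) * ennreal M"
    unfolding M_def transversal_mass(2)[OF ij, symmetric]
    by (rule nn_integral_component_diff[OF _ _ _ ij]) (auto simp: transversal_translate)
  also have "(\<integral>\<^sup>+s. ?f s \<partial>lborel) = ennreal (4 * C\<^sup>2 / R\<^sup>2) * ennreal R"
    using nn_integral_reciprocal[of "exp (- R)" 1] R by (simp add: nn_integral_cmult)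
  also have "\<dots> * ennreal M + ennreal (2 * N) = ennreal (4 * C\<^sup>2 / R * M + 2 * N)"
    using M N R by (simp add: ennreal_mult[symmetric] ennreal_plus[symmetric] power2_eq_square del: ennreal_plus)
  finally show ?thesis
    using M N R by (subst (asm) ennreal_le_iff) auto
qed

lemma hardy_weight_ge:
  fixes x :: "real^'n::{finite,linorder}"
  assumes "i \<noteq> j"
  shows "1 / (x $ i - x $ j)\<^sup>2 \<le> hardy_weight x"
proof -
  have "1 / \<bar>x $ k - x $ l\<bar>\<^sup>2 \<le> hardy_weight x" if "k < l" for k l
    using member_le_sum[of "(k, l)" "{(i, j). i < j}" "\<lambda>(i, j). 1 / \<bar>x $ i - x $ j\<bar>\<^sup>2"] that
    unfolding hardy_weight_def by auto
  from this[of i j] this[of j i] show ?thesis using assms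
    by (cases "i < j") (auto simp: power2_commute)
qed

section \<open>Sharpness of the constant\<close>

text \<open>By the ground state representation, the inequality with the constant \<open>c\<close> forces
  \<open>(c - 1/2) \<integral> v\<^sup>2/t \<le> \<integral> t \<bar>\<nabla>v\<bar>\<^sup>2\<close>.  For \<open>c > 1/2\<close> the left-hand side is unbounded in \<open>R\<close>, the right-hand side
  is not.\<close>

lemma hardy_constant_le:
  fixes c :: real
  assumes card: "CARD('n::{finite,linorder}) \<ge> 2"
    and H: "\<And>u. u \<in> H1_0 (UNIV - collision_set :: (real^'n::{finite,linorder}) set) \<Longrightarrow> ennreal c * hardy_integral u \<le> dirichlet_energy u"
  shows "c \<le> 1/2"
proof (rule ccontr)
  assume "\<not> c \<le> 1/2"
  then have c: "c > 1/2" by simp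
  obtain i j :: "'n::{finite,linorder}" where ij: "i \<noteq> j"
  proof -
    have "\<not> card (UNIV :: 'n::{finite,linorder} set) \<le> Suc 0" using card by simp
    then show ?thesis using that card_le_Suc0_iff_eq[of "UNIV :: 'n::{finite,linorder} set"] by auto
  qed
  obtain e :: "'n::{finite,linorder} \<Rightarrow> nat" where e: "inj e"
    using finite_imp_inj_to_nat_seg[of "UNIV :: 'n::{finite,linorder} set"] by auto
  \<comment> \<open>Centres that are at least \<open>10\<close> apart from each other.\<close>
  define p where "p k = 10 * real (e k)" for k
  have sep: "10 \<le> \<bar>p k - p l\<bar>" if "k \<noteq> l" for k l
  proof -
    have "e k \<noteq> e l" using e that by (auto dest: injD)
    then show ?thesis unfolding p_def by linarith
  qed
  obtain C where C: "\<And>R s. R > 0 \<Longrightarrow> \<exists>d. (log_bump R has_real_derivative d) (at s) \<and>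
     \<bar>d\<bar> \<le> (if exp (- R) \<le> s \<and> s \<le> 1 then C / (R * s) else 0)"
    using log_bump_deriv by blast
  define M where "M = (LINT x|lborel. indicator {0..1} (x $ i - x $ j) * (transversal p i x)\<^sup>2)"
  define N where "N = (LINT x|lborel. indicator {0..1} (x $ i - x $ j) *
      (\<Sum>k\<in>UNIV. (frechet_derivative (transversal p i) (at x) (axis k 1))\<^sup>2))"
  have M: "M > 0" using transversal_mass(1)[OF ij, of p] by (simp add: M_def)
  have bound: "(c - 1/2) * (exp (- 12) * R / 3 * M) \<le> 4 * C\<^sup>2 / R * M + 2 * N" if R: "R > 0" for R
  proof -
    define u where "u x = complex_of_real (sqrt (x $ i - x $ j) * trial p i j R x)" for x
    let ?B = "LINT x|lborel. (trial p i j R x)\<^sup>2 / (x $ i - x $ j)"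
    let ?A = "LINT x|lborel. (x $ i - x $ j) * (\<Sum>k\<in>UNIV. (frechet_derivative (trial p i j R) (at x) (axis k 1))\<^sup>2)"
    let ?K = "slab p i j (exp (- R)) 1"
    have t: "u \<in> test_functions (UNIV - collision_set)"
      unfolding u_def[abs_def] using trial_test_function[of p, OF sep ij R] .
    have pos: "0 < x $ i - x $ j" if "x \<in> ?K" for x using slab_pos[OF exp_gt_zero that] .
    have zero: "trial p i j R x = 0" if "x \<notin> ?K" for x using trial_eq_0[OF R that] .
    note gs = ground_state_identity[OF ij Ck_on_trial[OF R] compact_slab[OF ij, of p "exp (- R)" 1] pos zero u_def]
    note hi = hardy_inequality_test[OF t]
    let ?HW = "LINT x|lborel. (norm (u x))\<^sup>2 * hardy_weight x"
    have "?B \<le> ?HW"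
    proof (rule integral_mono[OF gs(2) hi(2)])
      fix x
      show "(trial p i j R x)\<^sup>2 / (x $ i - x $ j) \<le> (norm (u x))\<^sup>2 * hardy_weight x"
      proof (cases "x \<in> ?K")
        case True
        then have t: "0 < x $ i - x $ j" by (rule slab_pos[OF exp_gt_zero])
        have "(trial p i j R x)\<^sup>2 / (x $ i - x $ j) = (norm (u x))\<^sup>2 * (1 / (x $ i - x $ j)\<^sup>2)"
        proof -
          have "(norm (u x))\<^sup>2 = (x $ i - x $ j) * (trial p i j R x)\<^sup>2"
            unfolding u_def norm_of_real power2_abs power_mult_distrib using t by simp
          then show ?thesis using t by (simp add: power2_eq_square)
        qed
        also have "\<dots> \<le> (norm (u x))\<^sup>2 * hardy_weight x"
          by (intro mult_left_mono hardy_weight_ge ij) auto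
        finally show ?thesis .
      next
        case False
        then show ?thesis by (simp add: u_def trial_eq_0[OF R False])
      qed
    qed
    moreover have "c * ?HW \<le> ?A + 1/2 * ?B"
    proof -
      have "hardy_integral u = ennreal ?HW"
        unfolding hardy_integral_def hardy_weight_def[symmetric] nn_integral_completion
        by (rule nn_integral_eq_integral[OF hi(2)]) (auto simp: hardy_weight_nonneg)
      moreover have "dirichlet_energy u = ennreal (LINT x|lborel. (norm (gradient u x))\<^sup>2)"
        unfolding dirichlet_energy_eq[OF has_weak_gradient_test[OF t]] nn_integral_completion
        by (rule nn_integral_eq_integral[OF hi(3)]) auto
      ultimately have "ennreal c * ennreal ?HW \<le> ennreal (LINT x|lborel. (norm (gradient u x))\<^sup>2)"
        using H[OF test_functions_subset_H1_0[OF t]] by simp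
      then have "ennreal (c * ?HW) \<le> ennreal (LINT x|lborel. (norm (gradient u x))\<^sup>2)"
        using c by (simp add: ennreal_mult' )
      then have "c * ?HW \<le> (LINT x|lborel. (norm (gradient u x))\<^sup>2)"
        by (subst (asm) ennreal_le_iff) auto
      then show ?thesis using gs(3) by linarith
    qed
    moreover have "c * ?B \<le> c * ?HW" using c \<open>?B \<le> ?HW\<close> by (intro mult_left_mono) auto
    moreover have "?A \<le> 4 * C\<^sup>2 / R * M + 2 * N"
      unfolding M_def N_def by (rule trial_gradient_le[OF ij R C[OF R] gs(1)])
    ultimately have "(c - 1/2) * ?B \<le> 4 * C\<^sup>2 / R * M + 2 * N" by (simp add: left_diff_distrib)
    moreover have "(c - 1/2) * (exp (- 12) * R / 3 * M) \<le> (c - 1/2) * ?B"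
      unfolding M_def using c by (intro mult_left_mono trial_mass_ge[OF ij R gs(2)]) auto
    ultimately show ?thesis by linarith
  qed
  define \<alpha> where "\<alpha> = (c - 1/2) * exp (- 12) / 3 * M"
  have \<alpha>: "\<alpha> > 0" using c M by (simp add: \<alpha>_def)
  define Z where "Z = 4 * C\<^sup>2 * M + 2 * \<bar>N\<bar>"
  \<comment> \<open>This choice gives \<open>\<alpha> R = \<alpha> + Z > Z\<close>, contrary to the bound.\<close>
  define R where "R = 1 + Z / \<alpha>"
  have "Z \<ge> 0" using M by (simp add: Z_def)
  then have R: "R \<ge> 1" using \<alpha> by (simp add: R_def)
  have "\<alpha> * R = (c - 1/2) * (exp (- 12) * R / 3 * M)" by (simp add: \<alpha>_def)
  also have "\<dots> \<le> 4 * C\<^sup>2 / R * M + 2 * N" using R by (intro bound) simp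
  also have "\<dots> \<le> Z"
  proof -
    have "4 * C\<^sup>2 / R \<le> 4 * C\<^sup>2 / 1" using R by (intro divide_left_mono) auto
    then have "4 * C\<^sup>2 / R * M \<le> 4 * C\<^sup>2 * M" using M by (intro mult_right_mono) auto
    then show ?thesis unfolding Z_def by linarith
  qed
  finally have "\<alpha> * R \<le> Z" .
  moreover have "\<alpha> * R = \<alpha> + Z" using \<alpha> by (simp add: R_def distrib_left)
  ultimately show False using \<alpha> by simp
qed

theorem theorem2p5:
  assumes "CARD('n::{finite,linorder}) \<ge> 2"
  shows "(\<forall>u\<in>H1_0 (UNIV - collision_set :: (real^'n::{finite,linorder}) set).
            dirichlet_energy u \<ge> ennreal (1/2) * hardy_integral u)
       \<and> (\<forall>c::real. c > 1/2 \<longrightarrow>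
            \<not> (\<forall>u\<in>H1_0 (UNIV - collision_set :: (real^'n::{finite,linorder}) set).
                 dirichlet_energy u \<ge> ennreal c * hardy_integral u))"
proof (intro conjI ballI allI impI notI)
  show "ennreal (1/2) * hardy_integral u \<le> dirichlet_energy u"
    if "u \<in> H1_0 (UNIV - collision_set :: (real^'n::{finite,linorder}) set)" for u
    using hardy_inequality[OF that] .
  fix c :: real
  assume c: "c > 1/2" and "\<forall>u\<in>H1_0 (UNIV - collision_set :: (real^'n::{finite,linorder}) set).
                 dirichlet_energy u \<ge> ennreal c * hardy_integral u"
  then show False using hardy_constant_le[OF assms, of c] by auto
qed

end
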